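(* Let $q\in[1,2]$ and $r\in[2,\infty]$ with $\frac q2+\frac1r=1$. Let $\mathbb Q$ be a probability measure absolutely continuous with respect to $\mathbb P$ with $\mathrm d\mathbb Q/\mathrm d\mathbb P\in L_r(\mathbb P)$. Assume that for some $\alpha\in(0,2]$, $$\sup_{r'\in(0,1)}\Big\|(\omega,t)\mapsto (r')^\alpha\int_{r'<|z|\le1}\nu_t(\omega,\mathrm dz)\Big\|_{L_\infty(\Omega\times[0,T],\mathbb P\otimes\lambda)}<\infty.$$ Then for any $\theta\in(0,1]$ and any sequence $(\varepsilon_n)_{n\ge1}\subset(0,\infty)$ with $\inf_{n\ge1}\sqrt[\alpha]{n}\,\varepsilon_n>0$, there exists a constant $c\ge1$ such that for any $n\ge1$ and any $\tau_n\in\mathcal T_{\det}$ with $\#\tau_n=n+1$ one has $$\frac nc\le\Big\|\#\,\tau_n\sqcup\rho\big(\varepsilon_n,\tfrac{1-\theta}2\big)\Big\|_{L_q(\mathbb Q)}\le c\,n.$$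
   Context: **General setting.** Fix $T\in(0,\infty)$ and a complete probability space $(\Omega,\mathcal F,\mathbb P)$ with a right-continuous filtration $(\mathcal F_t)_{t\in[0,T]}$ such that $\mathcal F_0$ is generated by the $\mathbb P$-null sets only. $\lambda$ is Lebesgue measure, $\mathbb R_0=\mathbb R\setminus\{0\}$, $\inf\emptyset:=\infty$. $\mathrm{CL}([0,T])$ is the set of càdlàg adapted processes on $[0,T]$; $X_{0-}:=X_0$, $\Delta X:=X-X_-$. *Process $Z$.* $Z\in\mathrm{CL}([0,T])$ is a square integrable semimartingale with $$Z_t=Z_0+Z^{c}_t+\int_0^t\!\int_{\mathbb R_0}z\,(N_Z-\pi_Z)(\mathrm du,\mathrm dz)+\int_0^t b^Z_u\,\mathrm du,$$ where $Z_0\in\mathbb R$, $b^Z$ is progressively measurable, $Z^c$ is a continuous square integrable martingale with $Z^c_0=0$, $N_Z$ is the jump random measure of $Z$ and $\pi_Z$ its predictable compensator, such that: $\pi_Z(\omega,\mathrm dt,\mathrm dz)=\nu_t(\omega,\mathrm dz)\,\mathrm dt$ for all $\omega$, where $\nu_t(\omega,\cdot)$ is a transition kernel of Lévy measures ($\nu_t(\omega,\{0\})=0$, $\int(z^2\wedge1)\,\nu_t(\omega,\mathrm dz)<\infty$); $\mathrm d\langle Z^c\rangle_t=|a^Z_t|^2\mathrm dt$ with $a^Z$ progressively measurable and $a^Z\in L_\infty(\Omega\times[0,T],\mathbb P\otimes\lambda)$; $\int_0^T|b^Z_u|^2\mathrm du\in L_\infty(\mathbb P)$; and $(\omega,t)\mapsto\int_{\mathbb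 R}z^2\nu_t(\omega,\mathrm dz)$ lies in $L_\infty(\Omega\times[0,T],\mathbb P\otimes\lambda)$. *Process $S$.* $S\in\mathrm{CL}([0,T])$ is the strong solution of $\mathrm dS_t=\sigma(S_{t-})\,\mathrm dZ_t$, $S_0\in\mathcal R_S$, where $\mathcal R_S\subseteq\mathbb R$ is open, $\sigma:\mathcal R_S\to(0,\infty)$ is Lipschitz, and $S_t(\omega),S_{t-}(\omega)\in\mathcal R_S$ for all $(\omega,t)$. **Time-nets.** $\mathcal T_{\det}$ is the set of deterministic nets $\tau=(t_i)_{i=0}^n$ with $0=t_0<t_1<\dots<t_n=T$, $n\ge1$. For $\varepsilon>0$ and $\kappa\ge0$ let $\rho_0(\varepsilon,\kappa):=0$ and $\rho_i(\varepsilon,\kappa):=\inf\{t\in(\rho_{i-1}(\varepsilon,\kappa),T]:|\Delta S_t|>\sigma(S_{t-})\,\varepsilon(T-t)^\kappa\}\wedge T$ for $i\ge1$; $\rho(\varepsilon,\kappa):=(\rho_i(\varepsilon,\kappa))_{i\ge0}$. $\tau\sqcup\rho(\varepsilon,\kappa)$ denotes the random collection of time-knots in $[0,T]$ obtained by combining $\tau$ with $\rho(\varepsilon,\kappa)$ and re-ordering (so $\#\,\tau\sqcup\rho(\varepsilon,\kappa)$ is the number of distinct knots). *)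

theory Defs
  imports "HOL-Probability.Probability" "HOL-Probability.Stopping_Time"
    "HOL-Probability.Essential_Supremum"
begin

section \<open>\<open>L\<^sub>p\<close>-norms of \<open>[0,\<infinity>]\<close>-valued functions\<close>

text \<open>The power is meant for exponents \<open>p > 0\<close>.\<close>

definition ennpowr :: "ennreal \<Rightarrow> real \<Rightarrow> ennreal" where
  "ennpowr x p = (if x = \<infinity> then \<infinity> else ennreal (enn2real x powr p))"

text \<open>As for \<^const>\<open>esssup\<close>, non-measurable functions get norm \<open>\<infinity>\<close>, so a finite norm
  entails measurability.\<close>

definition Lp_norm :: "'a measure \<Rightarrow> ennreal \<Rightarrow> ('a \<Rightarrow> ennreal) \<Rightarrow> ennreal" where
  "Lp_norm M p f =
     (if f \<notin> borel_measurable M then \<infinity>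
      else if p = \<infinity> then esssup M f
      else ennpowr (\<integral>\<^sup>+ x. ennpowr (f x) (enn2real p) \<partial>M) (1 / enn2real p))"


section \<open>Processes on \<open>[0,T]\<close>\<close>

text \<open>A process is a function of time and sample point, of which only the values at times in
  \<open>{0..T}\<close> matter. A filtration over \<open>[0,T]\<close> is encoded as one over the type \<^typ>\<open>real\<close>
  (extend it constantly to the left of \<open>0\<close> and to the right of \<open>T\<close>).\<close>

type_synonym 'a process = "real \<Rightarrow> 'a \<Rightarrow> real"

definition time_space :: "real \<Rightarrow> real measure" where
  "time_space T = restrict_space lborel {0..T}"

definition adapted :: "(real \<Rightarrow> 'a measure) \<Rightarrow> real \<Rightarrow> 'a process \<Rightarrow> bool" where
  "adapted F T X \<longleftrightarrow> (\<forall>t\<in>{0..T}. X t \<in> borel_measurable (F t))"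

definition progressive :: "(real \<Rightarrow> 'a measure) \<Rightarrow> real \<Rightarrow> 'a process \<Rightarrow> bool" where
  "progressive F T X \<longleftrightarrow>
     (\<forall>t\<in>{0..T}. (\<lambda>(\<omega>, s). X s \<omega>) \<in> borel_measurable (F t \<Otimes>\<^sub>M restrict_space borel {0..t}))"

definition cadlag_path :: "real \<Rightarrow> (real \<Rightarrow> real) \<Rightarrow> bool" where
  "cadlag_path T f \<longleftrightarrow>
     (\<forall>t\<in>{0..<T}. (f \<longlongrightarrow> f t) (at_right t)) \<and>
     (\<forall>t\<in>{0<..T}. \<exists>l. (f \<longlongrightarrow> l) (at_left t))"

definition caglad_path :: "real \<Rightarrow> (real \<Rightarrow> real) \<Rightarrow> bool" where
  "caglad_path T f \<longleftrightarrow>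
     (\<forall>t\<in>{0<..T}. (f \<longlongrightarrow> f t) (at_left t)) \<and>
     (\<forall>t\<in>{0..<T}. \<exists>l. (f \<longlongrightarrow> l) (at_right t))"

definition CL :: "'a measure \<Rightarrow> (real \<Rightarrow> 'a measure) \<Rightarrow> real \<Rightarrow> 'a process set" where
  "CL M F T = {X. adapted F T X \<and> (\<forall>\<omega>\<in>space M. cadlag_path T (\<lambda>t. X t \<omega>))}"

definition continuous_paths :: "'a measure \<Rightarrow> real \<Rightarrow> 'a process \<Rightarrow> bool" where
  "continuous_paths M T X \<longleftrightarrow> (\<forall>\<omega>\<in>space M. continuous_on {0..T} (\<lambda>t. X t \<omega>))"

definition left_limit :: "'a process \<Rightarrow> 'a process" where
  "left_limit X t \<omega> = (if t = 0 then X 0 \<omega> else Lim (at_left t) (\<lambda>s. X s \<omega>))"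

definition jump :: "'a process \<Rightarrow> 'a process" where
  "jump X t \<omega> = X t \<omega> - left_limit X t \<omega>"

text \<open>The predictable \<open>\<sigma>\<close>-algebra on \<open>\<Omega> \<times> [0,T]\<close>.\<close>

definition predictable_sigma :: "'a measure \<Rightarrow> (real \<Rightarrow> 'a measure) \<Rightarrow> real \<Rightarrow> ('a \<times> real) measure"
  where
  "predictable_sigma M F T = sigma (space M \<times> {0..T})
     ({A \<times> {0} | A. A \<in> sets (F 0)} \<union>
      {A \<times> {s<..t} | A s t. 0 \<le> s \<and> s < t \<and> t \<le> T \<and> A \<in> sets (F s)})"

definition predictable :: "'a measure \<Rightarrow> (real \<Rightarrow> 'a measure) \<Rightarrow> real \<Rightarrow> 'a process \<Rightarrow> bool" where
  "predictable M F T X \<longleftrightarrow> (\<lambda>(\<omega>, t). X t \<omega>) \<in> borel_measurable (predictable_sigma M F T)"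


section \<open>Martingales and semimartingales\<close>

definition is_martingale :: "'a measure \<Rightarrow> (real \<Rightarrow> 'a measure) \<Rightarrow> real \<Rightarrow> 'a process \<Rightarrow> bool" where
  "is_martingale M F T X \<longleftrightarrow>
     X \<in> CL M F T \<and>
     (\<forall>t\<in>{0..T}. integrable M (X t)) \<and>
     (\<forall>s\<in>{0..T}. \<forall>t\<in>{s..T}. AE \<omega> in M. real_cond_exp M (F s) (X t) \<omega> = X s \<omega>)"

definition square_integrable :: "'a measure \<Rightarrow> real \<Rightarrow> 'a process \<Rightarrow> bool" where
  "square_integrable M T X \<longleftrightarrow> (\<forall>t\<in>{0..T}. integrable M (\<lambda>\<omega>. (X t \<omega>)\<^sup>2))"

text \<open>On the compact horizon a localizing sequence is one that is eventually equal to \<open>T\<close>.\<close>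

definition local_martingale :: "'a measure \<Rightarrow> (real \<Rightarrow> 'a measure) \<Rightarrow> real \<Rightarrow> 'a process \<Rightarrow> bool"
  where
  "local_martingale M F T X \<longleftrightarrow>
     X \<in> CL M F T \<and>
     (\<exists>\<tau> :: nat \<Rightarrow> 'a \<Rightarrow> real.
        (\<forall>k. stopping_time F (\<tau> k)) \<and>
        (\<forall>k. \<forall>\<omega>\<in>space M. 0 \<le> \<tau> k \<omega> \<and> \<tau> k \<omega> \<le> \<tau> (Suc k) \<omega> \<and> \<tau> k \<omega> \<le> T) \<and>
        (AE \<omega> in M. \<exists>k. \<tau> k \<omega> = T) \<and>
        (\<forall>k. is_martingale M F T (\<lambda>t \<omega>. X (min t (\<tau> k \<omega>)) \<omega>)))"

definition purely_discontinuous :: "'a measure \<Rightarrow> (real \<Rightarrow> 'a measure) \<Rightarrow> real \<Rightarrow> 'a process \<Rightarrow> bool"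
  where
  "purely_discontinuous M F T X \<longleftrightarrow>
     local_martingale M F T X \<and> (AE \<omega> in M. X 0 \<omega> = 0) \<and>
     (\<forall>Y. local_martingale M F T Y \<and> continuous_paths M T Y \<longrightarrow>
        local_martingale M F T (\<lambda>t \<omega>. X t \<omega> * Y t \<omega>))"

definition finite_variation_path :: "real \<Rightarrow> (real \<Rightarrow> real) \<Rightarrow> bool" where
  "finite_variation_path T f \<longleftrightarrow>
     (\<exists>C. \<forall>n. \<forall>p :: nat \<Rightarrow> real. mono p \<and> range p \<subseteq> {0..T} \<longrightarrow>
        (\<Sum>i<n. \<bar>f (p (Suc i)) - f (p i)\<bar>) \<le> C)"

definition semimartingale :: "'a measure \<Rightarrow> (real \<Rightarrow> 'a measure) \<Rightarrow> real \<Rightarrow> 'a process \<Rightarrow> bool"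
  where
  "semimartingale M F T X \<longleftrightarrow>
     X \<in> CL M F T \<and>
     (\<exists>L A. local_martingale M F T L \<and> A \<in> CL M F T \<and>
        (\<forall>\<omega>\<in>space M. finite_variation_path T (\<lambda>t. A t \<omega>)) \<and>
        (AE \<omega> in M. \<forall>t\<in>{0..T}. X t \<omega> = X 0 \<omega> + L t \<omega> + A t \<omega>))"

text \<open>\<open>A\<close> is a version of the predictable quadratic variation (angle bracket) of \<open>X\<close>.\<close>

definition angle_bracket ::
  "'a measure \<Rightarrow> (real \<Rightarrow> 'a measure) \<Rightarrow> real \<Rightarrow> 'a process \<Rightarrow> 'a process \<Rightarrow> bool" where
  "angle_bracket M F T X A \<longleftrightarrow>
     A \<in> CL M F T \<and> predictable M F T A \<and>
     (\<forall>\<omega>\<in>space M. A 0 \<omega> = 0 \<and> mono_on {0..T} (\<lambda>t. A t \<omega>)) \<and>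
     local_martingale M F T (\<lambda>t \<omega>. (X t \<omega>)\<^sup>2 - A t \<omega>)"


section \<open>Random measures\<close>

text \<open>Random measures live on \<open>[0,T] \<times> \<real>\<close>; they charge neither time \<open>0\<close> nor, in the cases used
  below, the mark \<open>0\<close>.\<close>

definition time_mark_space :: "real \<Rightarrow> (real \<times> real) measure" where
  "time_mark_space T = restrict_space borel {0..T} \<Otimes>\<^sub>M borel"

definition random_measure ::
  "'a measure \<Rightarrow> real \<Rightarrow> ('a \<Rightarrow> (real \<times> real) measure) \<Rightarrow> bool" where
  "random_measure M T \<mu> \<longleftrightarrow>
     (\<forall>\<omega>\<in>space M. sets (\<mu> \<omega>) = sets (time_mark_space T) \<and> emeasure (\<mu> \<omega>) ({0} \<times> UNIV) = 0) \<and>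
     (\<forall>B\<in>sets (time_mark_space T). (\<lambda>\<omega>. emeasure (\<mu> \<omega>) B) \<in> borel_measurable M)"

definition jump_measure :: "real \<Rightarrow> 'a process \<Rightarrow> 'a \<Rightarrow> (real \<times> real) measure" where
  "jump_measure T X \<omega> =
     distr (count_space {s\<in>{0<..T}. jump X s \<omega> \<noteq> 0}) (time_mark_space T) (\<lambda>s. (s, jump X s \<omega>))"

definition predictable_fun ::
  "'a measure \<Rightarrow> (real \<Rightarrow> 'a measure) \<Rightarrow> real \<Rightarrow> (('a \<times> real) \<times> real \<Rightarrow> ennreal) set" where
  "predictable_fun M F T = borel_measurable (predictable_sigma M F T \<Otimes>\<^sub>M borel)"

definition predictable_random_measure ::
  "'a measure \<Rightarrow> (real \<Rightarrow> 'a measure) \<Rightarrow> real \<Rightarrow> ('a \<Rightarrow> (real \<times> real) measure) \<Rightarrow> bool" where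
  "predictable_random_measure M F T \<mu> \<longleftrightarrow>
     random_measure M T \<mu> \<and>
     (\<forall>W\<in>predictable_fun M F T.
        (\<lambda>(\<omega>, t). \<integral>\<^sup>+ (s, z). W ((\<omega>, s), z) * indicator {0..t} s \<partial>\<mu> \<omega>)
          \<in> borel_measurable (predictable_sigma M F T))"

definition is_compensator ::
  "'a measure \<Rightarrow> (real \<Rightarrow> 'a measure) \<Rightarrow> real \<Rightarrow>
     ('a \<Rightarrow> (real \<times> real) measure) \<Rightarrow> ('a \<Rightarrow> (real \<times> real) measure) \<Rightarrow> bool" where
  "is_compensator M F T \<mu> \<pi> \<longleftrightarrow>
     predictable_random_measure M F T \<pi> \<and>
     (\<forall>W\<in>predictable_fun M F T.
        (\<integral>\<^sup>+ \<omega>. (\<integral>\<^sup>+ (s, z). W ((\<omega>, s), z) \<partial>\<mu> \<omega>) \<partial>M) =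
        (\<integral>\<^sup>+ \<omega>. (\<integral>\<^sup>+ (s, z). W ((\<omega>, s), z) \<partial>\<pi> \<omega>) \<partial>M))"

text \<open>\<open>Y\<close> is a version of the stochastic integral \<open>\<integral>\<^sub>0 \<integral> W(u,z) (\<mu> - \<pi>)(du,dz)\<close> in the sense of
  Jacod and Shiryaev (Limit Theorems for Stochastic Processes, II.1.27): the purely discontinuous
  local martingale whose jump at \<open>t\<close> is \<open>\<integral> W(t,z) \<mu>({t},dz) - \<integral> W(t,z) \<pi>({t},dz)\<close>.\<close>

definition compensated_integral ::
  "'a measure \<Rightarrow> (real \<Rightarrow> 'a measure) \<Rightarrow> real \<Rightarrow>
     ('a \<Rightarrow> (real \<times> real) measure) \<Rightarrow> ('a \<Rightarrow> (real \<times> real) measure) \<Rightarrow>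
     ('a \<Rightarrow> real \<times> real \<Rightarrow> real) \<Rightarrow> 'a process \<Rightarrow> bool" where
  "compensated_integral M F T \<mu> \<pi> W Y \<longleftrightarrow>
     purely_discontinuous M F T Y \<and>
     (AE \<omega> in M. \<forall>t\<in>{0..T}.
        set_integrable (\<mu> \<omega>) ({t} \<times> UNIV) (W \<omega>) \<and>
        set_integrable (\<pi> \<omega>) ({t} \<times> UNIV) (W \<omega>) \<and>
        jump Y t \<omega> =
          set_lebesgue_integral (\<mu> \<omega>) ({t} \<times> UNIV) (W \<omega>)
          - set_lebesgue_integral (\<pi> \<omega>) ({t} \<times> UNIV) (W \<omega>))"

definition levy_measure :: "real measure \<Rightarrow> bool" where
  "levy_measure m \<longleftrightarrow>
     sets m = sets borel \<and> emeasure m {0} = 0 \<and> (\<integral>\<^sup>+ z. ennreal (min (z\<^sup>2) 1) \<partial>m) < \<infinity>"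

definition levy_kernel :: "'a measure \<Rightarrow> real \<Rightarrow> (real \<Rightarrow> 'a \<Rightarrow> real measure) \<Rightarrow> bool" where
  "levy_kernel M T \<nu> \<longleftrightarrow>
     (\<forall>t\<in>{0..T}. \<forall>\<omega>\<in>space M. levy_measure (\<nu> t \<omega>)) \<and>
     (\<forall>B\<in>sets borel.
        (\<lambda>(\<omega>, t). emeasure (\<nu> t \<omega>) B) \<in> borel_measurable (M \<Otimes>\<^sub>M time_space T))"


section \<open>The stochastic integral of caglad integrands\<close>

definition ucp_lim :: "'a measure \<Rightarrow> real \<Rightarrow> (nat \<Rightarrow> 'a process) \<Rightarrow> 'a process \<Rightarrow> bool" where
  "ucp_lim M T Xs X \<longleftrightarrow>
     (\<forall>e>0. (\<lambda>k. measure M {\<omega>\<in>space M. \<exists>t\<in>{0..T}. \<bar>Xs k t \<omega> - X t \<omega>\<bar> > e}) \<longlonglongrightarrow> 0)"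

text \<open>Data of the simple predictable process
  \<open>h\<^sub>0 1\<^bsub>{0}\<^esub> + \<Sum>\<^bsub>i<k\<^esub> h\<^sub>i 1\<^bsub>(\<tau>\<^sub>i, \<tau>\<^bsub>i+1\<^esub>]\<^esub>\<close>.\<close>

type_synonym 'a simple_data = "nat \<times> ('a \<Rightarrow> real) \<times> (nat \<Rightarrow> 'a \<Rightarrow> real) \<times> (nat \<Rightarrow> 'a \<Rightarrow> real)"

fun simple_data :: "'a measure \<Rightarrow> (real \<Rightarrow> 'a measure) \<Rightarrow> real \<Rightarrow> 'a simple_data \<Rightarrow> bool" where
  "simple_data M F T (k, h0, \<tau>, h) \<longleftrightarrow>
     h0 \<in> borel_measurable (F 0) \<and>
     (\<forall>i\<le>k. stopping_time F (\<tau> i) \<and> (\<forall>\<omega>\<in>space M. 0 \<le> \<tau> i \<omega> \<and> \<tau> i \<omega> \<le> T)) \<and>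
     (\<forall>i<k. (\<forall>\<omega>\<in>space M. \<tau> i \<omega> \<le> \<tau> (Suc i) \<omega>) \<and>
            h i \<in> borel_measurable (filtration.pre_sigma (space M) F (\<tau> i)))"

fun simple_process :: "'a simple_data \<Rightarrow> 'a process" where
  "simple_process (k, h0, \<tau>, h) t \<omega> =
     h0 \<omega> * indicator {0} t + (\<Sum>i<k. h i \<omega> * indicator {\<tau> i \<omega><..\<tau> (Suc i) \<omega>} t)"

text \<open>The integral is over \<open>(0,t]\<close>, hence there is no contribution of \<open>h\<^sub>0\<close>.\<close>

fun simple_integral :: "'a simple_data \<Rightarrow> 'a process \<Rightarrow> 'a process" where
  "simple_integral (k, h0, \<tau>, h) X t \<omega> =
     (\<Sum>i<k. h i \<omega> * (X (min (\<tau> (Suc i) \<omega>) t) \<omega> - X (min (\<tau> i \<omega>) t) \<omega>))"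

text \<open>\<open>I\<close> is a version of \<open>\<integral>\<^bsub>(0,\<sqdot>]\<^esub> H dX\<close> for an adapted caglad \<open>H\<close>. For a semimartingale \<open>X\<close> the
  elementary integral extends uniquely and continuously (in ucp) from simple predictable to adapted
  caglad integrands; the graph of this extension is the closure of the elementary graph.\<close>

definition stochastic_integral ::
  "'a measure \<Rightarrow> (real \<Rightarrow> 'a measure) \<Rightarrow> real \<Rightarrow> 'a process \<Rightarrow> 'a process \<Rightarrow> 'a process \<Rightarrow> bool"
  where
  "stochastic_integral M F T H X I \<longleftrightarrow>
     semimartingale M F T X \<and>
     adapted F T H \<and> (\<forall>\<omega>\<in>space M. caglad_path T (\<lambda>t. H t \<omega>)) \<and>
     I \<in> CL M F T \<and>
     (\<exists>D :: nat \<Rightarrow> 'a simple_data.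
        (\<forall>k. simple_data M F T (D k)) \<and>
        ucp_lim M T (\<lambda>k. simple_process (D k)) H \<and>
        ucp_lim M T (\<lambda>k. simple_integral (D k) X) I)"


section \<open>The standing assumptions\<close>

locale filtered_prob_space = prob_space M + complete_measure M + filtration "space M" F
  for M :: "'a measure" and F :: "real \<Rightarrow> 'a measure" +
  fixes T :: real
  assumes T_pos: "0 < T"
    and F_sub: "\<And>t. sets (F t) \<subseteq> sets M"
    and F_right_continuous: "\<And>t. 0 \<le> t \<Longrightarrow> t < T \<Longrightarrow> sets (F t) = (\<Inter>s\<in>{t<..T}. sets (F s))"
    and F_0: "sets (F 0) = sigma_sets (space M) (null_sets M)"

locale driving_process = filtered_prob_space M F T
  for M :: "'a measure" and F T +
  fixes Z :: "'a process" and z0 :: real and Zc :: "'a process"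
    and \<pi>Z :: "'a \<Rightarrow> (real \<times> real) measure" and \<nu> :: "real \<Rightarrow> 'a \<Rightarrow> real measure"
    and aZ bZ :: "'a process"
  assumes Z_semimartingale: "semimartingale M F T Z"
    and Z_square_integrable: "square_integrable M T Z"
    and Zc_martingale: "is_martingale M F T Zc"
    and Zc_square_integrable: "square_integrable M T Zc"
    and Zc_continuous: "continuous_paths M T Zc"
    and Zc_0: "AE \<omega> in M. Zc 0 \<omega> = 0"
    and bZ_progressive: "progressive F T bZ"
    and aZ_progressive: "progressive F T aZ"
    and \<pi>Z_compensator: "is_compensator M F T (jump_measure T Z) \<pi>Z"
    and Z_decomposition:
      "\<exists>J. compensated_integral M F T (jump_measure T Z) \<pi>Z (\<lambda>_ (u, z). z) J \<and>
         (AE \<omega> in M. \<forall>t\<in>{0..T}.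
            Z t \<omega> = z0 + Zc t \<omega> + J t \<omega> + set_lebesgue_integral lborel {0..t} (\<lambda>u. bZ u \<omega>))"
    and \<nu>_kernel: "levy_kernel M T \<nu>"
    and \<pi>Z_density:
      "\<And>\<omega> B. \<omega> \<in> space M \<Longrightarrow> B \<in> sets (time_mark_space T) \<Longrightarrow>
         emeasure (\<pi>Z \<omega>) B = (\<integral>\<^sup>+ t. emeasure (\<nu> t \<omega>) {z. (t, z) \<in> B} \<partial>time_space T)"
    and Zc_bracket:
      "\<exists>A. angle_bracket M F T Zc A \<and>
         (AE \<omega> in M. \<forall>t\<in>{0..T}. A t \<omega> = set_lebesgue_integral lborel {0..t} (\<lambda>u. \<bar>aZ u \<omega>\<bar>\<^sup>2))"
    and aZ_bounded:
      "Lp_norm (M \<Otimes>\<^sub>M time_space T) \<infinity> (\<lambda>(\<omega>, t). ennreal \<bar>aZ t \<omega>\<bar>) < \<infinity>"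
    and bZ_bounded:
      "Lp_norm M \<infinity> (\<lambda>\<omega>. \<integral>\<^sup>+ u. ennreal (\<bar>bZ u \<omega>\<bar>\<^sup>2) \<partial>time_space T) < \<infinity>"
    and \<nu>_bounded:
      "Lp_norm (M \<Otimes>\<^sub>M time_space T) \<infinity> (\<lambda>(\<omega>, t). \<integral>\<^sup>+ z. ennreal (z\<^sup>2) \<partial>\<nu> t \<omega>) < \<infinity>"

locale price_process = driving_process M F T Z z0 Zc \<pi>Z \<nu> aZ bZ
  for M :: "'a measure" and F T Z z0 Zc \<pi>Z \<nu> aZ bZ +
  fixes S :: "'a process" and s0 :: real and R\<^sub>S :: "real set" and \<sigma> :: "real \<Rightarrow> real"
  assumes R\<^sub>S_open: "open R\<^sub>S"
    and s0_mem: "s0 \<in> R\<^sub>S"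
    and \<sigma>_pos: "\<And>x. x \<in> R\<^sub>S \<Longrightarrow> 0 < \<sigma> x"
    and \<sigma>_lipschitz: "\<exists>L. L-lipschitz_on R\<^sub>S \<sigma>"
    and S_CL: "S \<in> CL M F T"
    and S_mem: "\<And>\<omega> t. \<omega> \<in> space M \<Longrightarrow> t \<in> {0..T} \<Longrightarrow> S t \<omega> \<in> R\<^sub>S \<and> left_limit S t \<omega> \<in> R\<^sub>S"
    and S_solution:
      "\<exists>I. stochastic_integral M F T (\<lambda>t \<omega>. \<sigma> (left_limit S t \<omega>)) Z I \<and>
         (AE \<omega> in M. \<forall>t\<in>{0..T}. S t \<omega> = s0 + I t \<omega>)"


section \<open>Time-nets\<close>

text \<open>Deterministic nets are represented by the list of their knots.\<close>

definition T_det :: "real \<Rightarrow> real list set" where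
  "T_det T = {ts. 2 \<le> length ts \<and> sorted_wrt (<) ts \<and> hd ts = 0 \<and> last ts = T}"

text \<open>\<open>x\<^sup>\<kappa>\<close> for \<open>x, \<kappa> \<ge> 0\<close>, with \<open>0\<^sup>0 = 1\<close> (whereas \<open>0 powr 0 = 0\<close>).\<close>

definition npow :: "real \<Rightarrow> real \<Rightarrow> real" where
  "npow x \<kappa> = (if \<kappa> = 0 then 1 else x powr \<kappa>)"

text \<open>The case distinction implements \<open>inf \<emptyset> = \<infinity>\<close>.\<close>

fun rho :: "real \<Rightarrow> (real \<Rightarrow> real) \<Rightarrow> 'a process \<Rightarrow> real \<Rightarrow> real \<Rightarrow> nat \<Rightarrow> 'a \<Rightarrow> real" where
  "rho T \<sigma> S \<epsilon> \<kappa> 0 \<omega> = 0"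
| "rho T \<sigma> S \<epsilon> \<kappa> (Suc i) \<omega> =
     (let A = {t \<in> {rho T \<sigma> S \<epsilon> \<kappa> i \<omega> <.. T}.
                 \<bar>jump S t \<omega>\<bar> > \<sigma> (left_limit S t \<omega>) * \<epsilon> * npow (T - t) \<kappa>}
      in if A = {} then T else min (Inf A) T)"

definition combined_net ::
  "real \<Rightarrow> (real \<Rightarrow> real) \<Rightarrow> 'a process \<Rightarrow> real list \<Rightarrow> real \<Rightarrow> real \<Rightarrow> 'a \<Rightarrow> real set" where
  "combined_net T \<sigma> S \<tau> \<epsilon> \<kappa> \<omega> = set \<tau> \<union> range (\<lambda>i. rho T \<sigma> S \<epsilon> \<kappa> i \<omega>)"

text \<open>The number of distinct knots may be infinite.\<close>

definition num_knots :: "real set \<Rightarrow> ennreal" where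
  "num_knots A = emeasure (count_space UNIV) A"

end

theory Submission
  imports Defs
begin

text \<open>
  The jumps of \<open>S\<close> are \<open>\<sigma>(S\<^sub>-) \<Delta>Z\<close>, so up to the knots of \<open>\<tau>\<close> the net consists of the set \<open>J\<close> of times
  \<open>t\<close> with \<open>\<bar>\<Delta>Z\<^sub>t\<bar> > \<epsilon> (T - t)\<^sup>\<kappa>\<close>. The compensator of the counting process of \<open>J\<close> is at most
  \<open>\<integral> C (\<epsilon>\<^sup>-\<^sup>\<alpha> (T - t)\<^sup>-\<^sup>\<kappa>\<^sup>\<alpha> + 1) dt\<close>, which is \<open>O(n)\<close> since \<open>\<kappa> \<alpha> < 1\<close> and \<open>\<epsilon>\<^sub>n\<^sup>-\<^sup>\<alpha> = O(n)\<close>. For a finite set,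
  \<open>#J\<^sup>2 = \<Sum>\<^bsub>s\<in>J\<^esub> (2 #(J \<inter> (0,s)) + 1)\<close> with a predictable summand, so the compensator also yields
  \<open>E #J\<^sup>2 = O(n\<^sup>2)\<close>, and the integrability of the density transfers this to \<open>L\<^sub>q(Q)\<close>. The lower bound
  is immediate from the \<open>n + 1\<close> knots of \<open>\<tau>\<close>.
\<close>

section \<open>Counting lemmas and the refining times\<close>

text \<open>The set J is defined through Z but the net through S, and the stochastic integral is
  given only as a ucp limit of elementary integrals. The jump relation between S and Z therefore
  holds merely almost surely and has to be extracted from that limit. The successive infima defining
  the net are sure to enumerate J once J is finite, and so is the square formula to apply; hence the
  first moment of #J comes before the second, since it gives finiteness almost surely. Finally, a
  non-measurable function has norm \<infinity>, so the upper bound requires genuine measurability of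
  the knot count: events are reduced to countably many path values, and completeness of the space
  absorbs the null set on which the descriptions by S and by Z differ.

  The second moment is the right target because q/2 + 1/r = 1 says that r and 2/q are conjugate
  exponents: a density in L_r pairs with the q-th power of a square integrable count. The condition
  \<alpha> \<le> 2 enters through \<kappa>\<alpha> \<le> 1 - \<theta> < 1, which makes the
  compensator integrable in time near T.\<close>

definition jump_times :: "real \<Rightarrow> 'a process \<Rightarrow> (real \<Rightarrow> real) \<Rightarrow> 'a \<Rightarrow> real set" where
  "jump_times T X g \<omega> = {t \<in> {0<..T}. g t < \<bar>jump X t \<omega>\<bar>}"

text \<open>Listed in increasing order, the summands are the odd numbers 1, 3, 5, and so on. Only
  strictly earlier elements enter each summand, which is what later makes the integrand
  predictable.\<close>

lemma sum_rank_eq_square: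
  fixes J :: "real set"
  assumes "finite J"
  shows "(\<Sum>s\<in>J. 2 * card {u\<in>J. u < s} + 1) = (card J)\<^sup>2"
  using assms
proof (induction J rule: finite_linorder_max_induct)
  case (insert b A)
  have 1: "{u \<in> insert b A. u < b} = A" using insert by auto
  have 2: "{u \<in> insert b A. u < s} = {u \<in> A. u < s}" if "s \<in> A" for s
    using insert that by force
  have "b \<notin> A" using insert by auto
  have "(\<Sum>s\<in>insert b A. 2 * card {u \<in> insert b A. u < s} + 1)
     = (2 * card A + 1) + (\<Sum>s\<in>A. 2 * card {u \<in> A. u < s} + 1)"
    unfolding sum.insert[OF insert(1) \<open>b \<notin> A\<close>] 1 using 2 by (intro arg_cong2[where f="(+)"] sum.cong refl) simp
  also have "\<dots> = (card (insert b A))\<^sup>2"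
    using insert \<open>b \<notin> A\<close> by (simp add: power2_eq_square)
  finally show ?case .
qed simp

text \<open>For finite \<open>J \<omega>\<close> each infimum is a minimum, so every step moves to
  the next element of \<open>J \<omega>\<close>, and to \<open>T\<close> once none is left.\<close>

lemma range_rho:
  fixes T \<epsilon> \<kappa> :: real and \<sigma> :: "real \<Rightarrow> real" and S :: "'a process"
  defines "J \<omega> \<equiv> {t \<in> {0<..T}. \<bar>jump S t \<omega>\<bar> > \<sigma> (left_limit S t \<omega>) * \<epsilon> * npow (T - t) \<kappa>}"
  assumes T: "0 < T" and fin: "finite (J \<omega>)"
  shows "range (\<lambda>i. rho T \<sigma> S \<epsilon> \<kappa> i \<omega>) = {0} \<union> J \<omega> \<union> {T}"
proof -
  define \<rho> where "\<rho> i = rho T \<sigma> S \<epsilon> \<kappa> i \<omega>" for i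
  define A where "A i = {t \<in> J \<omega>. \<rho> i < t}" for i
  have \<rho>0: "\<rho> 0 = 0" by (simp add: \<rho>_def)
  have A_fin: "finite (A i)" for i using fin by (simp add: A_def)
  have step: "\<rho> (Suc i) = (if A i = {} then T else Min (A i))" if "0 \<le> \<rho> i" for i
  proof -
    have eq: "{t \<in> {\<rho> i <.. T}. \<bar>jump S t \<omega>\<bar> > \<sigma> (left_limit S t \<omega>) * \<epsilon> * npow (T - t) \<kappa>} = A i"
      using that by (auto simp: A_def J_def)
    have "Min (A i) \<le> T" if "A i \<noteq> {}"
      using Min_in[OF A_fin that] by (simp add: A_def J_def)
    then show ?thesis
      using eq A_fin[of i] by (auto simp: \<rho>_def Let_def cInf_eq_Min min_def)
  qed
  have step': "\<rho> (Suc i) \<in> J \<omega> \<union> {T} \<and> 0 \<le> \<rho> (Suc i)" if "0 \<le> \<rho> i" for i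
  proof (cases "A i = {}")
    case True then show ?thesis using step[OF that] T by simp
  next
    case False then show ?thesis
      using step[OF that] Min_in[OF A_fin False] that by (simp add: A_def[of i, symmetric]) (simp add: A_def)
  qed
  have nonneg: "0 \<le> \<rho> i" for i by (induction i) (use \<rho>0 step' in auto)
  have sub: "range \<rho> \<subseteq> {0} \<union> J \<omega> \<union> {T}"
  proof clarify
    fix i assume "\<rho> i \<notin> J \<omega>" "\<rho> i \<noteq> T"
    then show "\<rho> i = 0" using \<rho>0 step'[OF nonneg] by (cases i) auto
  qed
  \<comment> \<open>If \<open>t\<close> is never hit, the sequence can never pass it, so it
    increases strictly inside \<open>J \<omega>\<close> forever, against finiteness.\<close>
  have hit: "\<exists>i. \<rho> i = t" if t: "t \<in> J \<omega>" for t
  proof (rule ccontr)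
    assume no: "\<nexists>i. \<rho> i = t"
    have less: "\<rho> i < t" for i
    proof (induction i)
      case 0 then show ?case using t \<rho>0 by (simp add: J_def)
    next
      case (Suc i)
      then have "t \<in> A i" using t by (simp add: A_def)
      then have "\<rho> (Suc i) \<le> t" using step[OF nonneg] A_fin by (auto intro: Min_le)
      with no show ?case by (metis order_le_less)
    qed
    have inA: "\<rho> (Suc i) \<in> A i" for i
    proof -
      have "t \<in> A i" using t less by (simp add: A_def)
      then show ?thesis using step[OF nonneg, of i] Min_in[OF A_fin[of i]] by auto
    qed
    then have "strict_mono \<rho>" by (auto simp: strict_mono_Suc_iff A_def)
    then have "inj \<rho>" by (rule strict_mono_imp_inj_on)
    then have "infinite (range (\<lambda>i. \<rho> (Suc i)))"
      by (intro range_inj_infinite) (auto simp: inj_def)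
    moreover have "range (\<lambda>i. \<rho> (Suc i)) \<subseteq> J \<omega>" using inA by (auto simp: A_def)
    ultimately show False using fin finite_subset by blast
  qed
  \<comment> \<open>\<open>T\<close> need not belong to \<open>J \<omega>\<close>; it is reached one
    step after the maximum of \<open>J \<omega>\<close>, where no later candidate exists.\<close>
  have "\<exists>i. \<rho> i = T"
  proof (cases "J \<omega> = {}")
    case True
    then have "\<rho> 1 = T" using step[OF nonneg, of 0] by (simp add: A_def)
    then show ?thesis by blast
  next
    case False
    then obtain i where i: "\<rho> i = Max (J \<omega>)" using hit Max_in[OF fin] by metis
    then have "A i = {}" using Max_ge[OF fin] by (auto simp: A_def not_less)
    then have "\<rho> (Suc i) = T" using step[OF nonneg] by simp
    then show ?thesis by blast
  qed
  then have "{0} \<union> J \<omega> \<union> {T} \<subseteq> range \<rho>" using hit \<rho>0 by (force simp: image_iff)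
  with sub show ?thesis unfolding \<rho>_def by blast
qed

text \<open>Reduces a count to countably many events of the form "J meets this cell". Cells of one
  partition are disjoint, so the number of occupied ones never exceeds the count; conversely, a mesh
  below the smallest gap of a finite subset puts its points into different cells.\<close>

lemma emeasure_count_space_eq_SUP_partition:
  fixes J :: "real set" and b :: real
  assumes b: "0 < b" and J: "J \<subseteq> {0<..b}"
  shows "emeasure (count_space UNIV) J =
    (SUP k. of_nat (card {i\<in>{..k}. J \<inter> {b * i / Suc k <.. b * Suc i / Suc k} \<noteq> {}}))"
    (is "_ = (SUP k. of_nat (card (?I k)))")
proof (rule antisym)
  show "(SUP k. of_nat (card (?I k))) \<le> emeasure (count_space UNIV) J"
  proof (rule SUP_least)
    fix k
    define f where "f i = (SOME x. x \<in> J \<inter> {b * real i / Suc k <.. b * Suc i / Suc k})" for i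
    have f: "f i \<in> J" "b * real i / Suc k < f i" "f i \<le> b * Suc i / Suc k" if "i \<in> ?I k" for i
      using that some_in_eq[of "J \<inter> {b * real i / Suc k <.. b * Suc i / Suc k}"]
      unfolding f_def by auto
    have less: "f i < f j" if "i < j" "i \<in> ?I k" "j \<in> ?I k" for i j
    proof -
      have "b * Suc i / Suc k \<le> b * j / Suc k"
        using \<open>i < j\<close> b by (intro divide_right_mono mult_left_mono) auto
      then show ?thesis using f(3)[OF that(2)] f(2)[OF that(3)] by linarith
    qed
    have "inj_on f (?I k)"
    proof (rule inj_onI)
      fix i j assume ij: "i \<in> ?I k" "j \<in> ?I k" "f i = f j"
      show "i = j"
        using less[of i j, OF _ ij(1,2)] less[of j i, OF _ ij(2,1)] ij(3)
        by (cases i j rule: linorder_cases) simp_all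
    qed
    then have "card (?I k) = card (f ` ?I k)" by (simp add: card_image)
    also have "of_nat \<dots> = emeasure (count_space UNIV) (f ` ?I k)"
      by (simp add: emeasure_count_space_finite)
    also have "\<dots> \<le> emeasure (count_space UNIV) J"
      using f(1) by (intro emeasure_mono) auto
    finally show "of_nat (card (?I k)) \<le> emeasure (count_space UNIV) J" .
  qed
  have fin: "of_nat (card E) \<le> (SUP k. of_nat (card (?I k)) :: ennreal)"
    if E: "finite E" "E \<subseteq> J" for E
  proof -
    obtain d where d: "d > 0" "\<And>x y. x \<in> E \<Longrightarrow> y \<in> E \<Longrightarrow> x \<noteq> y \<Longrightarrow> d \<le> \<bar>x - y\<bar>"
    proof -
      \<comment> \<open>The element 1 keeps \<open>D\<close> nonempty when \<open>E\<close> has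
        fewer than two points.\<close>
      define D where "D = insert 1 ((\<lambda>(x,y). \<bar>x - y\<bar>) ` {p \<in> E \<times> E. fst p \<noteq> snd p})"
      have D: "finite D" "D \<noteq> {}" using E by (auto simp: D_def)
      have "Min D > 0" using D by (subst Min_gr_iff) (auto simp: D_def)
      moreover have "Min D \<le> \<bar>x - y\<bar>" if "x \<in> E" "y \<in> E" "x \<noteq> y" for x y
        using that D by (intro Min_le) (auto simp: D_def image_iff)
      ultimately show ?thesis using that by blast
    qed
    obtain k :: nat where "b / d < real k" using reals_Archimedean2 by blast
    then have k: "b / d < Suc k" by simp
    define m where "m = Suc k"
    have bm: "b / real m < d" using k d(1) by (simp add: field_simps m_def)
    have m: "m > 0" by (simp add: m_def)
    \<comment> \<open>Index of the cell containing \<open>x\<close>. Cells are open on the left and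
      closed on the right, hence ceiling minus one instead of floor.\<close>
    define f where "f x = nat (\<lceil>x * m / b\<rceil> - 1)" for x :: real
    have f: "f x \<in> ?I k \<and> b * f x / m < x \<and> x \<le> b * Suc (f x) / m" if "x \<in> E" for x
    proof -
      have x: "0 < x" "x \<le> b" "x \<in> J" using that E J by auto
      have pos: "0 < x * m / b" using x b m by simp
      then have c: "\<lceil>x * m / b\<rceil> \<ge> 1" by linarith
      have le: "\<lceil>x * m / b\<rceil> \<le> m"
        using x b m by (subst ceiling_le_iff) (simp add: field_simps)
      have r: "real (f x) = of_int \<lceil>x * m / b\<rceil> - 1" using c by (simp add: f_def)
      have 1: "real (f x) < x * m / b" unfolding r by linarith
      have 2: "x * m / b \<le> real (Suc (f x))" using r by simp
      have 3: "b * f x / m < x" using 1 b m by (simp add: field_simps)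
      have 4: "x \<le> b * Suc (f x) / m" using 2 b m by (simp add: field_simps)
      have "f x \<le> k" using le c by (auto simp: f_def m_def)
      then show ?thesis using 3 4 x by (auto simp: m_def)
    qed
    have "inj_on f E"
    proof (rule inj_onI, rule ccontr)
      fix x y assume xy: "x \<in> E" "y \<in> E" "f x = f y" "x \<noteq> y"
      have "\<bar>x - y\<bar> < b * Suc (f x) / m - b * f x / m"
        using f[OF xy(1)] f[OF xy(2)] xy(3) by (auto simp: abs_if)
      also have "\<dots> = b / m" by (simp add: field_simps diff_divide_distrib[symmetric])
      finally show False using d(2)[OF xy(1,2,4)] bm by linarith
    qed
    then have "card E \<le> card (?I k)" using f by (intro card_inj_on_le[of f]) auto
    then have "(of_nat (card E) :: ennreal) \<le> of_nat (card (?I k))" by simp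
    also have "\<dots> \<le> (SUP k. of_nat (card (?I k)))" by (rule SUP_upper) simp
    finally show ?thesis .
  qed
  show "emeasure (count_space UNIV) J \<le> (SUP k. of_nat (card (?I k)))"
  proof (cases "finite J")
    case True then show ?thesis using fin[of J] by (simp add: emeasure_count_space_finite)
  next
    case False
    have "(of_nat n :: ennreal) \<le> (SUP k. of_nat (card (?I k)))" for n
    proof -
      obtain E where E: "finite E" "card E = n" "E \<subseteq> J"
        using infinite_arbitrarily_large[OF False, of n] by blast
      show ?thesis using fin[OF E(1,3)] unfolding E(2) .
    qed
    then have "(SUP n. of_nat n :: ennreal) \<le> (SUP k. of_nat (card (?I k)))"
      by (rule SUP_least)
    then have "top \<le> (SUP k. of_nat (card (?I k)) :: ennreal)"
      unfolding ennreal_SUP_of_nat_eq_top .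
    then show ?thesis by (rule order_trans[OF top_greatest])
  qed
qed


section \<open>Measurability of jump counts of cadlag processes\<close>

lemma cadlag_path_left_limit:
  assumes "cadlag_path T f" "t \<in> {0<..T}"
  shows "(f \<longlongrightarrow> Lim (at_left t) f) (at_left t)"
proof -
  obtain l where "(f \<longlongrightarrow> l) (at_left t)"
    using assms unfolding cadlag_path_def by blast
  then show ?thesis by (simp add: tendsto_Lim)
qed

text \<open>A jump above the threshold is detected by increments over arbitrarily short intervals
  with endpoints in a countable set. The margin \<open>1 / Suc m\<close> has two roles: it turns
  strict inequalities into ones that survive a limit, and it keeps limit points away from the
  excluded endpoint \<open>a\<close>. All sampling times lie in (a, b], so nothing after
  \<open>b\<close> is looked at.\<close>

lemma cadlag_path_jump_iff:
  fixes a b T :: real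
  assumes f: "cadlag_path T f" and g: "continuous_on {0..T} g" "\<And>t. t \<in> {0..T} \<Longrightarrow> 0 \<le> g t"
    and ab: "0 \<le> a" "a < b" "b \<le> T"
  defines "C \<equiv> insert b ({a<..b} \<inter> \<rat>)"
  shows "(\<exists>s\<in>{a<..b}. g s < \<bar>f s - Lim (at_left s) f\<bar>) \<longleftrightarrow>
    (\<exists>m::nat. \<forall>k::nat. \<exists>u\<in>C. \<exists>v\<in>C. a + 1 / Suc m \<le> u \<and> u < v \<and> v - u < 1 / Suc k \<and>
       g u + 1 / Suc m \<le> \<bar>f v - f u\<bar>)" (is "?L \<longleftrightarrow> ?R")
proof
  assume ?L
  then obtain s where s: "a < s" "s \<le> b" and big: "g s < \<bar>f s - Lim (at_left s) f\<bar>" by auto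
  define l where "l = Lim (at_left s) f"
  have s': "s \<in> {0<..T}" using s ab by auto
  have fl: "(f \<longlongrightarrow> l) (at_left s)" unfolding l_def by (rule cadlag_path_left_limit[OF f s'])
  have "(g \<longlongrightarrow> g s) (at s within {0..T})" using g(1) s' by (auto simp: continuous_on_def)
  then have "(g \<longlongrightarrow> g s) (at s within {0..<s})"
    by (rule tendsto_within_subset) (use s' in auto)
  moreover have "at s within {0..<s} = at_left s"
    using s' by (intro at_within_nhd[of _ "{0<..}"]) auto
  ultimately have gl: "(g \<longlongrightarrow> g s) (at_left s)" by simp
  obtain m :: nat where m: "1 / Suc m < min (\<bar>f s - l\<bar> - g s) (s - a)"
    using big s nat_approx_posE[of "min (\<bar>f s - l\<bar> - g s) (s - a)"] by (auto simp: l_def)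
  have "\<exists>u\<in>C. \<exists>v\<in>C. a + 1 / Suc m \<le> u \<and> u < v \<and> v - u < 1 / Suc k \<and>
       g u + 1 / Suc m \<le> \<bar>f v - f u\<bar>" for k
  proof -
    define d where "d = 1 / real (Suc k)"
    have d: "d > 0" by (simp add: d_def)
    have "((\<lambda>u. \<bar>f s - f u\<bar> - g u) \<longlongrightarrow> \<bar>f s - l\<bar> - g s) (at_left s)"
      by (intro tendsto_intros fl gl)
    then have "\<forall>\<^sub>F u in at_left s. 1 / Suc m < \<bar>f s - f u\<bar> - g u"
      using m by (intro order_tendstoD(1)) auto
    moreover have "\<forall>\<^sub>F u in at_left s. max (a + 1 / Suc m) (s - d/2) < u"
      using m d eventually_at_left_real[of "max (a + 1 / Suc m) (s - d/2)" s]
      by (auto elim!: eventually_mono)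
    ultimately have "\<forall>\<^sub>F u in at_left s. 1 / Suc m < \<bar>f s - f u\<bar> - g u \<and> max (a + 1 / Suc m) (s - d/2) < u"
      by eventually_elim auto
    then obtain c where c: "c < s"
      "\<And>u. c < u \<Longrightarrow> u < s \<Longrightarrow> 1 / Suc m < \<bar>f s - f u\<bar> - g u \<and> max (a + 1 / Suc m) (s - d/2) < u"
      unfolding eventually_at_left_field by blast
    obtain u where u: "u \<in> \<rat>" "c < u" "u < s" using Rats_dense_in_real[OF c(1)] by blast
    note u' = c(2)[OF u(2,3)]
    have "a < a + 1 / Suc m" by simp
    then have "a < u" using u' by linarith
    then have uC: "u \<in> C" using u s by (auto simp: C_def)
    \<comment> \<open>At \<open>s = b\<close> there is no room to the right inside the interval, so
      \<open>v\<close> must be \<open>b\<close> itself; this is why \<open>C\<close> contains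
      \<open>b\<close> even if it is irrational.\<close>
    show ?thesis
    proof (cases "s = b")
      case True
      then have "b - u < 1 / Suc k" using u' d unfolding d_def[symmetric] by linarith
      then show ?thesis using True uC u u' by (intro bexI[of _ u] bexI[of _ b]) (auto simp: C_def)
    next
      case False
      then have sb: "s < b" using s by simp
      have "(f \<longlongrightarrow> f s) (at_right s)" using f sb s ab by (auto simp: cadlag_path_def)
      then have "((\<lambda>v. \<bar>f v - f u\<bar> - g u) \<longlongrightarrow> \<bar>f s - f u\<bar> - g u) (at_right s)"
        by (intro tendsto_intros)
      then have "\<forall>\<^sub>F v in at_right s. 1 / Suc m < \<bar>f v - f u\<bar> - g u"
        using u' by (intro order_tendstoD(1)) auto
      moreover have "\<forall>\<^sub>F v in at_right s. v < min b (s + d/2)"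
        using sb d eventually_at_right_real[of s "min b (s + d/2)"] by (auto elim!: eventually_mono)
      ultimately have "\<forall>\<^sub>F v in at_right s. 1 / Suc m < \<bar>f v - f u\<bar> - g u \<and> v < min b (s + d/2)"
        by eventually_elim auto
      then obtain c' where c': "s < c'"
        "\<And>v. s < v \<Longrightarrow> v < c' \<Longrightarrow> 1 / Suc m < \<bar>f v - f u\<bar> - g u \<and> v < min b (s + d/2)"
        unfolding eventually_at_right_field by blast
      obtain v where v: "v \<in> \<rat>" "s < v" "v < c'" using Rats_dense_in_real[OF c'(1)] by blast
      note v' = c'(2)[OF v(2,3)]
      have "v \<in> C" using v v' s by (auto simp: C_def)
      moreover have "v - u < 1 / Suc k" using u' v' d unfolding d_def[symmetric] by linarith
      ultimately show ?thesis using uC u u' v v' by (intro bexI[of _ u] bexI[of _ v]) auto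
    qed
  qed
  then show ?R by blast
next
  assume ?R
  then obtain m :: nat where "\<forall>k::nat. \<exists>u\<in>C. \<exists>v\<in>C. a + 1 / Suc m \<le> u \<and> u < v \<and> v - u < 1 / Suc k \<and>
       g u + 1 / Suc m \<le> \<bar>f v - f u\<bar>" by blast
  then obtain u v where uv: "\<And>k. u k \<in> C" "\<And>k. v k \<in> C" "\<And>k. a + 1 / Suc m \<le> u k" "\<And>k. u k < v k"
     "\<And>k::nat. v k - u k < 1 / Suc k" "\<And>k. g (u k) + 1 / Suc m \<le> \<bar>f (v k) - f (u k)\<bar>"
    by metis
  define c where "c = 1 / real (Suc m)"
  have c: "c > 0" by (simp add: c_def)
  have C_le: "x \<in> C \<Longrightarrow> a < x \<and> x \<le> b" for x using ab by (auto simp: C_def)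
  have "compact {a + c..b}" by simp
  moreover have "\<forall>k. u k \<in> {a + c..b}" using uv(1,3) C_le by (auto simp: c_def)
  ultimately obtain s r where sr: "s \<in> {a + c..b}" "strict_mono r" "(u \<circ> r) \<longlonglongrightarrow> s"
    unfolding compact_def by metis
  have s: "a < s" "s \<le> b" "s \<in> {0<..T}" using sr c ab by auto
  define l where "l = Lim (at_left s) f"
  have fl: "(f \<longlongrightarrow> l) (at_left s)" unfolding l_def by (rule cadlag_path_left_limit[OF f s(3)])
  have "\<forall>\<^sub>F x in at_left s. dist (f x) l < c / 4" using fl c by (intro tendstoD) auto
  then obtain c1 where c1: "c1 < s" "\<And>x. c1 < x \<Longrightarrow> x < s \<Longrightarrow> \<bar>f x - l\<bar> < c / 4"
    unfolding eventually_at_left_field dist_real_def by blast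
  obtain c2 where c2: "s < c2" "\<And>x. s \<le> x \<Longrightarrow> x < c2 \<Longrightarrow> x \<le> b \<Longrightarrow> \<bar>f x - f s\<bar> < c / 4"
  proof (cases "s = b")
    case True then show ?thesis using that[of "s + 1"] c by auto
  next
    case False
    then have "(f \<longlongrightarrow> f s) (at_right s)" using f s ab by (auto simp: cadlag_path_def)
    then have "\<forall>\<^sub>F x in at_right s. dist (f x) (f s) < c / 4" using c by (intro tendstoD) auto
    then obtain c2 where "s < c2" "\<And>x. s < x \<Longrightarrow> x < c2 \<Longrightarrow> \<bar>f x - f s\<bar> < c / 4"
      unfolding eventually_at_right_field dist_real_def by blast
    then show ?thesis using that[of c2] c by (metis abs_zero diff_self divide_pos_pos order_le_less zero_less_numeral)
  qed
  obtain d where d: "d > 0" "\<And>x. x \<in> {0..T} \<Longrightarrow> \<bar>x - s\<bar> < d \<Longrightarrow> \<bar>g x - g s\<bar> < c / 4"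
    using g(1) s(3) c unfolding continuous_on_iff dist_real_def
    by (metis atLeastAtMost_iff divide_pos_pos greaterThanAtMost_iff less_imp_le zero_less_numeral)
  \<comment> \<open>The point \<open>x\<close> will be within \<open>e\<close> of \<open>s\<close>
    and \<open>y\<close> less than \<open>e\<close> to the right of \<open>x\<close>, so
    \<open>y\<close> stays below \<open>s + 2 * e\<close>; halving keeps both in all three
    neighbourhoods.\<close>
  define e where "e = min d (min (s - c1) (c2 - s)) / 2"
  have e: "e > 0" using d c1 c2 by (simp add: e_def)
  have "\<forall>\<^sub>F j in sequentially. dist ((u \<circ> r) j) s < e" using sr(3) e by (intro tendstoD)
  moreover have "(\<lambda>j. 1 / real (Suc j)) \<longlonglongrightarrow> 0" using LIMSEQ_inverse_real_of_nat by (simp add: inverse_eq_divide)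
  then have "\<forall>\<^sub>F j in sequentially. 1 / real (Suc j) < e" using e by (rule order_tendstoD(2))
  ultimately have "\<forall>\<^sub>F j in sequentially. \<bar>u (r j) - s\<bar> < e \<and> 1 / real (Suc j) < e"
    by eventually_elim (auto simp: dist_real_def)
  then obtain j where j: "\<bar>u (r j) - s\<bar> < e" "1 / real (Suc j) < e"
    using eventually_happens'[OF sequentially_bot] by blast
  have "1 / real (Suc (r j)) \<le> 1 / real (Suc j)"
    using seq_suble[OF sr(2), of j] by (intro divide_left_mono) auto
  then have vu: "v (r j) - u (r j) < e" using uv(5)[of "r j"] j(2) by linarith
  define x y where "x = u (r j)" and "y = v (r j)"
  have xy: "x < y" "\<bar>x - s\<bar> < e" "y - x < e" "a < x" "y \<le> b" "g x + c \<le> \<bar>f y - f x\<bar>"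
    using uv(4,6)[of "r j"] j vu C_le[OF uv(1)[of "r j"]] C_le[OF uv(2)[of "r j"]] by (auto simp: x_def y_def c_def)
  have e2: "2 * e \<le> d" "2 * e \<le> s - c1" "2 * e \<le> c2 - s" by (auto simp: e_def)
  have range: "c1 < x" "y < c2" "\<bar>x - s\<bar> < d" using xy e2 e by linarith+
  have x0: "x \<in> {0..T}" using xy ab by auto
  have gx: "0 \<le> g x" "\<bar>g x - g s\<bar> < c / 4" using g(2) d(2) x0 range(3) by auto
  \<comment> \<open>If both points lie on the same side of \<open>s\<close>, the increment is below
    c/2, although it is at least c. Hence they straddle \<open>s\<close>; then the increment differs
    from the jump at \<open>s\<close> by less than c/2 and \<open>g x\<close> from
    \<open>g s\<close> by less than c/4, which leaves a positive margin.\<close>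
  consider "y < s" | "s \<le> x" | "x < s" "s \<le> y" by linarith
  then have "g s < \<bar>f s - l\<bar>"
  proof cases
    case 1
    then have "\<bar>f y - l\<bar> < c/4" "\<bar>f x - l\<bar> < c/4" using c1(2) range xy by auto
    then show ?thesis using xy(6) gx c by linarith
  next
    case 2
    then have "\<bar>f y - f s\<bar> < c/4" "\<bar>f x - f s\<bar> < c/4" using c2(2) range xy by auto
    then show ?thesis using xy(6) gx c by linarith
  next
    case 3
    then have "\<bar>f y - f s\<bar> < c/4" "\<bar>f x - l\<bar> < c/4" using c2(2) c1(2) range xy by auto
    then show ?thesis using xy(6) gx c by linarith
  qed
  then show ?L using s unfolding l_def by auto
qed

lemma (in filtration) measurable_F_mono:
  assumes "f \<in> F s \<rightarrow>\<^sub>M N" "s \<le> t"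
  shows "f \<in> F t \<rightarrow>\<^sub>M N"
  using assms(1) sets_F_mono[OF assms(2)] by (auto simp: measurable_def space_F)

context filtered_prob_space
begin

text \<open>The event is decided by time \<open>b\<close>. This adaptedness, beyond measurability in
  \<open>M\<close>, is what yields a predictable integrand for the second moment.\<close>

lemma sets_jump_event:
  assumes X: "X \<in> CL M F T"
    and g: "continuous_on {0..T} g" "\<And>t. t \<in> {0..T} \<Longrightarrow> 0 \<le> g t"
    and ab: "0 \<le> a" "a < b" "b \<le> T"
  shows "{\<omega>\<in>space M. \<exists>s\<in>{a<..b}. g s < \<bar>jump X s \<omega>\<bar>} \<in> sets (F b)"
proof -
  define C where "C = insert b ({a<..b} \<inter> \<rat>)"
  have C: "countable C" unfolding C_def by (intro countable_insert countable_Int2 countable_rat)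
  have meas: "X u \<in> borel_measurable (F b)" if "u \<in> C" for u
  proof (rule measurable_F_mono)
    show "X u \<in> borel_measurable (F u)" using X that ab by (auto simp: CL_def adapted_def C_def)
    show "u \<le> b" using that by (auto simp: C_def)
  qed
  have "{\<omega>\<in>space M. \<exists>s\<in>{a<..b}. g s < \<bar>jump X s \<omega>\<bar>} =
    {\<omega>\<in>space (F b). \<exists>m::nat. \<forall>k::nat. \<exists>u\<in>C. \<exists>v\<in>C. a + 1 / Suc m \<le> u \<and> u < v \<and> v - u < 1 / Suc k \<and>
       g u + 1 / Suc m \<le> \<bar>X v \<omega> - X u \<omega>\<bar>}" (is "?A = ?B")
  proof (intro Collect_cong conj_cong)
    fix \<omega> assume "\<omega> \<in> space (F b)"
    then have "cadlag_path T (\<lambda>t. X t \<omega>)" using X by (auto simp: CL_def space_F)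
    from cadlag_path_jump_iff[OF this g ab]
    show "(\<exists>s\<in>{a<..b}. g s < \<bar>jump X s \<omega>\<bar>) \<longleftrightarrow> (\<exists>m::nat. \<forall>k::nat. \<exists>u\<in>C. \<exists>v\<in>C. a + 1 / Suc m \<le> u \<and> u < v \<and> v - u < 1 / Suc k \<and>
       g u + 1 / Suc m \<le> \<bar>X v \<omega> - X u \<omega>\<bar>)"
      using ab(1) by (auto simp: jump_def left_limit_def C_def)
  qed (simp add: space_F)
  also have "?B \<in> sets (F b)"
    using C meas by (intro sets.sets_Collect sets.sets_Collect_countable_Ex sets.sets_Collect_countable_All
      sets.sets_Collect_countable_Ex') measurable
  finally show ?thesis .
qed

text \<open>The deterministic set \<open>A\<close> lets one statement serve twice: with
  \<open>A\<close> empty for the jump count itself, and with \<open>A\<close> the positive knots of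
  a net for the number of combined knots.\<close>

lemma measurable_count_jump_times:
  assumes X: "X \<in> CL M F T"
    and g: "continuous_on {0..T} g" "\<And>t. t \<in> {0..T} \<Longrightarrow> 0 \<le> g t"
    and b: "0 < b" "b \<le> T" and A: "A \<subseteq> {0<..b}"
  shows "(\<lambda>\<omega>. emeasure (count_space UNIV) (A \<union> (jump_times T X g \<omega> \<inter> {..b}))) \<in> borel_measurable (F b)"
proof -
  define I where "I k i = {b * real i / real (Suc k) <.. b * real (Suc i) / real (Suc k)}" for k i :: nat
  define J where "J \<omega> = A \<union> (jump_times T X g \<omega> \<inter> {..b})" for \<omega>
  have "emeasure (count_space UNIV) (J \<omega>) = (SUP k. \<Sum>i\<le>k. if J \<omega> \<inter> I k i \<noteq> {} then 1 else 0)" for \<omega>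
  proof -
    have "J \<omega> \<subseteq> {0<..b}" using A by (auto simp: J_def jump_times_def)
    from emeasure_count_space_eq_SUP_partition[OF b(1) this] show ?thesis
      by (simp add: I_def[symmetric] sum.If_cases Int_def del: of_nat_Suc)
  qed
  moreover have "(\<lambda>\<omega>. SUP k. \<Sum>i\<le>k. if J \<omega> \<inter> I k i \<noteq> {} then 1 else 0 :: ennreal) \<in> borel_measurable (F b)"
  proof (intro borel_measurable_SUP borel_measurable_sum measurable_If)
    fix k i :: nat assume "i \<in> {..k}"
    then have ik: "i \<le> k" by simp
    let ?a = "b * real i / real (Suc k)" and ?b = "b * real (Suc i) / real (Suc k)"
    have ab: "0 \<le> ?a" "?a < ?b" using b by (auto intro!: divide_strict_right_mono mult_strict_left_mono)
    have "?b \<le> b * 1" unfolding times_divide_eq_right[symmetric]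
      using b ik by (intro mult_left_mono) (auto simp: divide_le_eq)
    then have bb: "?b \<le> b" by simp
    have "{\<omega>\<in>space M. \<exists>s\<in>{?a<..?b}. g s < \<bar>jump X s \<omega>\<bar>} \<in> sets (F b)"
      using sets_jump_event[OF X g ab] bb b sets_F_mono[OF bb] by auto
    then have "{\<omega>\<in>space (F b). A \<inter> I k i \<noteq> {} \<or> (\<exists>s\<in>{?a<..?b}. g s < \<bar>jump X s \<omega>\<bar>)} \<in> sets (F b)"
      by (intro sets.sets_Collect_disj sets.sets_Collect_const) (simp add: space_F)
    also have "{\<omega>\<in>space (F b). A \<inter> I k i \<noteq> {} \<or> (\<exists>s\<in>{?a<..?b}. g s < \<bar>jump X s \<omega>\<bar>)} =
       {\<omega>\<in>space (F b). J \<omega> \<inter> I k i \<noteq> {}}"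
    proof (intro Collect_cong conj_cong refl)
      fix \<omega>
      have "s \<in> jump_times T X g \<omega> \<inter> {..b} \<longleftrightarrow> g s < \<bar>jump X s \<omega>\<bar>" if "s \<in> I k i" for s
      proof -
        have "?a < s" "s \<le> ?b" using that by (auto simp only: I_def greaterThanAtMost_iff)
        then have "0 < s" "s \<le> b" "s \<le> T" using ab bb b by linarith+
        then show ?thesis by (simp add: jump_times_def)
      qed
      then show "(A \<inter> I k i \<noteq> {} \<or> (\<exists>s\<in>{?a<..?b}. g s < \<bar>jump X s \<omega>\<bar>)) \<longleftrightarrow> J \<omega> \<inter> I k i \<noteq> {}"
        unfolding J_def I_def[of k i, symmetric] by blast
    qed
    finally show "{\<omega>\<in>space (F b). J \<omega> \<inter> I k i \<noteq> {}} \<in> sets (F b)" .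
  qed auto
  ultimately show ?thesis unfolding J_def by simp
qed

end


section \<open>Jumps of stochastic integrals\<close>

text \<open>A path stopped at \<open>r\<close> still makes the jump at time \<open>r\<close>, hence
  the weak inequality \<open>t \<le> r\<close>. It matches the right-closed intervals of simple
  processes.\<close>

lemma cadlag_path_stopped_left:
  assumes "cadlag_path T (\<lambda>t. X t \<omega>)" "t \<in> {0<..T}"
  shows "((\<lambda>s. X (min r s) \<omega>) \<longlongrightarrow> X (min r t) \<omega> - (if t \<le> r then jump X t \<omega> else 0)) (at_left t)"
proof (cases "t \<le> r")
  case True
  have "((\<lambda>s. X s \<omega>) \<longlongrightarrow> left_limit X t \<omega>) (at_left t)"
    using cadlag_path_left_limit[OF assms] assms(2) by (simp add: left_limit_def)
  moreover have "\<forall>\<^sub>F s in at_left t. X s \<omega> = X (min r s) \<omega>"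
    using True eventually_at_left_real[of "t - 1" t] by (auto elim!: eventually_mono simp: min_def)
  ultimately show ?thesis using True by (auto intro: Lim_transform_eventually simp: jump_def min_def)
next
  case False
  have "\<forall>\<^sub>F s in at_left t. X r \<omega> = X (min r s) \<omega>"
    using False eventually_at_left_real[of r t] by (auto elim!: eventually_mono simp: min_def)
  then show ?thesis using False by (auto intro!: Lim_transform_eventually[OF tendsto_const])
qed

lemma cadlag_path_stopped_right:
  assumes "cadlag_path T (\<lambda>t. X t \<omega>)" "t \<in> {0..<T}"
  shows "((\<lambda>s. X (min r s) \<omega>) \<longlongrightarrow> X (min r t) \<omega>) (at_right t)"
proof (cases "t < r")
  case True
  have "((\<lambda>s. X s \<omega>) \<longlongrightarrow> X t \<omega>) (at_right t)"
    using assms unfolding cadlag_path_def by blast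
  moreover have "\<forall>\<^sub>F s in at_right t. X s \<omega> = X (min r s) \<omega>"
    using True eventually_at_right_real[of t r] by (auto elim!: eventually_mono simp: min_def)
  ultimately show ?thesis using True by (auto intro: Lim_transform_eventually simp: min_def)
next
  case False
  have "\<forall>\<^sub>F s in at_right t. X r \<omega> = X (min r s) \<omega>"
    using False eventually_at_right_real[of t "t + 1"] by (auto elim!: eventually_mono simp: min_def)
  then show ?thesis using False by (auto intro!: Lim_transform_eventually[OF tendsto_const])
qed

lemma indicator_left_continuous:
  fixes a b t :: real
  shows "(indicator {a<..b} \<longlongrightarrow> (indicator {a<..b} t :: real)) (at_left t)"
proof -
  have "\<forall>\<^sub>F s in at_left t. indicator {a<..b} t = (indicator {a<..b} s :: real)"
  proof -
    \<comment> \<open>Chosen so that the indicator is constant on (c, t].\<close>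
    define c where "c = (if a < t then (if b < t then max a b else a) else t - 1)"
    have "c < t" by (auto simp: c_def)
    from eventually_at_left_real[OF this] show ?thesis
      by eventually_elim (auto simp: c_def indicator_def split: if_splits)
  qed
  then show ?thesis by (rule Lim_transform_eventually[OF tendsto_const])
qed

lemma simple_process_left_continuous:
  assumes "0 < t"
  shows "((\<lambda>s. simple_process D s \<omega>) \<longlongrightarrow> simple_process D t \<omega>) (at_left t)"
proof (cases D)
  case (fields k h0 \<tau> h)
  have "\<forall>\<^sub>F s in at_left t. 0 = (indicator {0} s :: real)"
    using eventually_at_left_real[OF assms] by (auto elim!: eventually_mono)
  then have "(indicator {0} \<longlongrightarrow> (indicator {0} t :: real)) (at_left t)"
    using assms by (auto intro!: Lim_transform_eventually[OF tendsto_const])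
  then show ?thesis
    unfolding fields simple_process.simps by (intro tendsto_intros indicator_left_continuous)
qed

context filtered_prob_space
begin

section \<open>Measurability and jumps of elementary integrals\<close>

lemma measurable_F_M: "f \<in> F t \<rightarrow>\<^sub>M N \<Longrightarrow> f \<in> M \<rightarrow>\<^sub>M N"
  using F_sub[of t] by (auto simp: measurable_def space_F)

text \<open>By right-continuity the value at \<open>R\<close> is the limit of values at grid times
  approaching \<open>R\<close> from the right, and each approximating time takes only countably many
  values.\<close>

lemma measurable_CL_at_random_time:
  assumes X: "X \<in> CL M F T" and R[measurable]: "R \<in> borel_measurable M"
    and R_range: "\<And>\<omega>. \<omega> \<in> space M \<Longrightarrow> R \<omega> \<in> {0..T}"
  shows "(\<lambda>\<omega>. X (R \<omega>) \<omega>) \<in> borel_measurable M"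
proof -
  \<comment> \<open>Floor plus one gives a grid point strictly to the right of \<open>x\<close>.
    Clamping to [0, T] makes every integer index admissible and returns exactly \<open>T\<close> at
    \<open>x = T\<close>, where no right limit is available.\<close>
  define d where "d k x = min T (max 0 ((of_int \<lfloor>x * real (Suc k)\<rfloor> + 1) / real (Suc k)))" for k x
  show ?thesis
  proof (rule borel_measurable_LIMSEQ_real)
    fix k :: nat
    have 1: "(\<lambda>\<omega>. X (min T (max 0 ((of_int i + 1) / real (Suc k)))) \<omega>) \<in> borel_measurable M" for i :: int
    proof -
      have "min T (max 0 ((of_int i + 1) / real (Suc k))) \<in> {0..T}" using T_pos by auto
      then show ?thesis using X measurable_F_M unfolding CL_def adapted_def by blast
    qed
    have 2: "(\<lambda>\<omega>. \<lfloor>R \<omega> * real (Suc k)\<rfloor>) \<in> M \<rightarrow>\<^sub>M count_space UNIV" by measurable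
    show "(\<lambda>\<omega>. X (d k (R \<omega>)) \<omega>) \<in> borel_measurable M"
      unfolding d_def by (rule measurable_compose_countable[OF 1 2])
  next
    fix \<omega> assume \<omega>: "\<omega> \<in> space M"
    define x where "x = R \<omega>"
    have x: "0 \<le> x" "x \<le> T" using R_range[OF \<omega>] by (auto simp: x_def)
    have up: "x < (of_int \<lfloor>x * real (Suc k)\<rfloor> + 1) / real (Suc k)" for k
    proof -
      have "x * real (Suc k) < of_int \<lfloor>x * real (Suc k)\<rfloor> + 1" by linarith
      then show ?thesis by (simp add: pos_less_divide_eq del: of_nat_Suc)
    qed
    have lo: "(of_int \<lfloor>x * real (Suc k)\<rfloor> + 1) / real (Suc k) \<le> x + 1 / real (Suc k)" for k
    proof -
      have "of_int \<lfloor>x * real (Suc k)\<rfloor> + 1 \<le> x * real (Suc k) + 1" by simp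
      then have "(of_int \<lfloor>x * real (Suc k)\<rfloor> + 1) / real (Suc k) \<le> (x * real (Suc k) + 1) / real (Suc k)"
        by (rule divide_right_mono) simp
      then show ?thesis by (simp add: add_divide_distrib del: of_nat_Suc)
    qed
    show "(\<lambda>k. X (d k (R \<omega>)) \<omega>) \<longlonglongrightarrow> X (R \<omega>) \<omega>"
    proof (cases "x = T")
      case True
      have "d k x = T" for k using up[of k] True by (simp add: d_def)
      then show ?thesis using True by (simp add: x_def)
    next
      case False
      then have xT: "x < T" using x by simp
      have d1: "x < d k x" "d k x \<le> x + 1 / real (Suc k)" for k
        using up[of k] lo[of k] xT x by (auto simp: d_def min_def max_def simp del: of_nat_Suc)
      have lim: "(\<lambda>k. x + 1 / real (Suc k)) \<longlonglongrightarrow> x"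
        using tendsto_add[OF tendsto_const[of x] LIMSEQ_inverse_real_of_nat] by (simp add: inverse_eq_divide)
      have "(\<lambda>k. d k x) \<longlonglongrightarrow> x"
        by (rule tendsto_sandwich[OF _ _ tendsto_const lim]) (use d1 in \<open>auto simp: less_imp_le\<close>)
      then have "filterlim (\<lambda>k. d k x) (at_right x) sequentially"
        by (rule tendsto_imp_filterlim_at_right) (use d1 in auto)
      moreover have "((\<lambda>t. X t \<omega>) \<longlongrightarrow> X x \<omega>) (at_right x)"
        using X \<omega> xT x by (auto simp: CL_def cadlag_path_def)
      ultimately show ?thesis unfolding x_def[symmetric] by (rule filterlim_compose[rotated])
    qed
  qed
qed

text \<open>One-sided continuity at interior times is enough to carry an exceedance to a nearby
  rational time; the endpoints are put into the countable set by hand. The disjunction covers both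
  uses: differences of integrands are left-continuous, differences of integrals
  right-continuous.\<close>

lemma sets_exceedance_event:
  fixes Y :: "real \<Rightarrow> 'a \<Rightarrow> real"
  assumes meas: "\<And>t. t \<in> {0..T} \<Longrightarrow> Y t \<in> borel_measurable M"
    and reg: "\<And>\<omega> t. \<omega> \<in> space M \<Longrightarrow> t \<in> {0<..<T} \<Longrightarrow>
      ((\<lambda>s. Y s \<omega>) \<longlongrightarrow> Y t \<omega>) (at_left t) \<or> ((\<lambda>s. Y s \<omega>) \<longlongrightarrow> Y t \<omega>) (at_right t)"
  shows "{\<omega>\<in>space M. \<exists>t\<in>{0..T}. e < \<bar>Y t \<omega>\<bar>} \<in> sets M"
proof -
  define C where "C = {0, T} \<union> ({0..T} \<inter> \<rat>)"
  have C: "countable C" "C \<subseteq> {0..T}"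
    unfolding C_def using T_pos by (auto intro: countable_Int2 countable_rat)
  have "(\<exists>t\<in>{0..T}. e < \<bar>Y t \<omega>\<bar>) \<longleftrightarrow> (\<exists>t\<in>C. e < \<bar>Y t \<omega>\<bar>)" if \<omega>: "\<omega> \<in> space M" for \<omega>
  proof
    assume "\<exists>t\<in>{0..T}. e < \<bar>Y t \<omega>\<bar>"
    then obtain t where t: "t \<in> {0..T}" "e < \<bar>Y t \<omega>\<bar>" by blast
    show "\<exists>t\<in>C. e < \<bar>Y t \<omega>\<bar>"
    proof (cases "t \<in> {0, T}")
      case True then show ?thesis using t by (auto simp: C_def)
    next
      case False
      then have t': "t \<in> {0<..<T}" using t by auto
      from reg[OF \<omega> t'] show ?thesis
      proof
        assume "((\<lambda>s. Y s \<omega>) \<longlongrightarrow> Y t \<omega>) (at_left t)"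
        then have "\<forall>\<^sub>F s in at_left t. e < \<bar>Y s \<omega>\<bar>" using t(2) by (intro order_tendstoD(1)[OF tendsto_rabs])
        then obtain c where c: "c < t" "\<And>s. c < s \<Longrightarrow> s < t \<Longrightarrow> e < \<bar>Y s \<omega>\<bar>"
          unfolding eventually_at_left_field by blast
        have "max 0 c < t" using c t' by auto
        then obtain s where "s \<in> \<rat>" "max 0 c < s" "s < t" using Rats_dense_in_real by blast
        then show ?thesis using c t' by (intro bexI[of _ s]) (auto simp: C_def)
      next
        assume "((\<lambda>s. Y s \<omega>) \<longlongrightarrow> Y t \<omega>) (at_right t)"
        then have "\<forall>\<^sub>F s in at_right t. e < \<bar>Y s \<omega>\<bar>" using t(2) by (intro order_tendstoD(1)[OF tendsto_rabs])
        then obtain c where c: "t < c" "\<And>s. t < s \<Longrightarrow> s < c \<Longrightarrow> e < \<bar>Y s \<omega>\<bar>"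
          unfolding eventually_at_right_field by blast
        have "t < min T c" using c t' by auto
        then obtain s where "s \<in> \<rat>" "t < s" "s < min T c" using Rats_dense_in_real by blast
        then show ?thesis using c t' by (intro bexI[of _ s]) (auto simp: C_def)
      qed
    qed
  qed (use C in blast)
  then have "{\<omega>\<in>space M. \<exists>t\<in>{0..T}. e < \<bar>Y t \<omega>\<bar>} = {\<omega>\<in>space M. \<exists>t\<in>C. e < \<bar>Y t \<omega>\<bar>}" by blast
  also have "\<dots> \<in> sets M"
  proof (rule sets.sets_Collect_countable_Ex'[OF _ C(1)])
    fix t assume "t \<in> C"
    then have [measurable]: "Y t \<in> borel_measurable M" using C meas by blast
    show "{\<omega>\<in>space M. e < \<bar>Y t \<omega>\<bar>} \<in> sets M" by measurable
  qed
  finally show ?thesis .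
qed

lemma simple_data_measurable:
  assumes "simple_data M F T (k, h0, \<tau>, h)"
  shows "i \<le> k \<Longrightarrow> \<tau> i \<in> borel_measurable M" "i < k \<Longrightarrow> h i \<in> borel_measurable M"
    "h0 \<in> borel_measurable M"
proof -
  show \<tau>: "\<tau> i \<in> borel_measurable M" if "i \<le> k" for i
    using assms that by (intro measurable_stopping_time[of F]) (auto simp: F_sub[THEN subsetD] space_F)
  show "h0 \<in> borel_measurable M" using assms measurable_F_M by auto
  show "h i \<in> borel_measurable M" if "i < k" for i
  proof -
    have st: "stopping_time F (\<tau> i)" and le: "\<And>\<omega>. \<omega> \<in> space M \<Longrightarrow> \<tau> i \<omega> \<le> T"
      and h: "h i \<in> borel_measurable (pre_sigma (\<tau> i))" using assms that by auto
    have "sets (pre_sigma (\<tau> i)) \<subseteq> sets M"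
    proof
      fix A assume A: "A \<in> sets (pre_sigma (\<tau> i))"
      have "A \<subseteq> space M" using sets.sets_into_space[OF A] by (simp add: space_pre_sigma)
      then have "{\<omega>\<in>A. \<tau> i \<omega> \<le> T} = A" using le by auto
      then show "A \<in> sets M" using sets_pre_sigmaD[OF st A, of T] F_sub by auto
    qed
    then show ?thesis using h by (auto simp: measurable_def space_pre_sigma)
  qed
qed

lemma simple_process_measurable:
  assumes "simple_data M F T D"
  shows "simple_process D t \<in> borel_measurable M"
proof (cases D)
  case (fields k h0 \<tau> h)
  note meas = simple_data_measurable[OF assms[unfolded fields]]
  have "(\<lambda>\<omega>. indicator {\<tau> i \<omega><..\<tau> (Suc i) \<omega>} t :: real) \<in> borel_measurable M" if "i < k" for i
  proof -
    have [measurable]: "\<tau> i \<in> borel_measurable M" "\<tau> (Suc i) \<in> borel_measurable M"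
      using meas(1) that by auto
    show ?thesis unfolding indicator_def greaterThanAtMost_iff by measurable
  qed
  then show ?thesis unfolding fields simple_process.simps
    using meas by (intro borel_measurable_add borel_measurable_times borel_measurable_sum) auto
qed

lemma simple_integral_measurable:
  assumes D: "simple_data M F T D" and X: "X \<in> CL M F T" and t: "t \<in> {0..T}"
  shows "simple_integral D X t \<in> borel_measurable M"
proof (cases D)
  case (fields k h0 \<tau> h)
  note meas = simple_data_measurable[OF D[unfolded fields]]
  have "(\<lambda>\<omega>. X (min (\<tau> i \<omega>) t) \<omega>) \<in> borel_measurable M" if "i \<le> k" for i
  proof (rule measurable_CL_at_random_time[OF X])
    show "(\<lambda>\<omega>. min (\<tau> i \<omega>) t) \<in> borel_measurable M" using meas(1)[OF that] by simp
    show "min (\<tau> i \<omega>) t \<in> {0..T}" if "\<omega> \<in> space M" for \<omega>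
      using D that \<open>i \<le> k\<close> t by (auto simp: fields min_le_iff_disj)
  qed
  then show ?thesis unfolding fields simple_integral.simps
    using meas by (intro borel_measurable_diff borel_measurable_times borel_measurable_sum) auto
qed

text \<open>In the difference of two consecutive stopped paths the subtracted jumps cancel unless
  \<open>t\<close> lies in (\<tau> i, \<tau> (i+1)]. So the jump of the elementary integral at
  \<open>t\<close> is the integrand at \<open>t\<close> times the jump of \<open>X\<close>.\<close>

lemma simple_integral_left_limit:
  assumes D: "simple_data M F T D" and X: "X \<in> CL M F T" and t: "t \<in> {0<..T}" and \<omega>: "\<omega> \<in> space M"
  shows "((\<lambda>s. simple_integral D X s \<omega>) \<longlongrightarrow>
    simple_integral D X t \<omega> - simple_process D t \<omega> * jump X t \<omega>) (at_left t)"
proof (cases D)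
  case (fields k h0 \<tau> h)
  have c: "cadlag_path T (\<lambda>t. X t \<omega>)" using X \<omega> by (simp add: CL_def)
  let ?L = "\<lambda>i. X (min (\<tau> i \<omega>) t) \<omega> - (if t \<le> \<tau> i \<omega> then jump X t \<omega> else 0)"
  have "((\<lambda>s. simple_integral D X s \<omega>) \<longlongrightarrow> (\<Sum>i<k. h i \<omega> * (?L (Suc i) - ?L i))) (at_left t)"
    unfolding fields simple_integral.simps by (intro tendsto_intros cadlag_path_stopped_left[where T=T and X=X and \<omega>=\<omega>] c t)
  also have "(\<Sum>i<k. h i \<omega> * (?L (Suc i) - ?L i)) =
     (\<Sum>i<k. h i \<omega> * (X (min (\<tau> (Suc i) \<omega>) t) \<omega> - X (min (\<tau> i \<omega>) t) \<omega>)
        - h i \<omega> * indicator {\<tau> i \<omega><..\<tau> (Suc i) \<omega>} t * jump X t \<omega>)"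
  proof (intro sum.cong refl)
    fix i assume "i \<in> {..<k}"
    then have "\<tau> i \<omega> \<le> \<tau> (Suc i) \<omega>" using D \<omega> by (auto simp: fields)
    then show "h i \<omega> * (?L (Suc i) - ?L i) = h i \<omega> * (X (min (\<tau> (Suc i) \<omega>) t) \<omega> - X (min (\<tau> i \<omega>) t) \<omega>)
        - h i \<omega> * indicator {\<tau> i \<omega><..\<tau> (Suc i) \<omega>} t * jump X t \<omega>"
      by (auto simp: indicator_def algebra_simps)
  qed
  also have "\<dots> = simple_integral D X t \<omega> - simple_process D t \<omega> * jump X t \<omega>"
    using t by (simp add: fields sum_subtractf sum_distrib_right del: sum_mult_indicator)
  finally show ?thesis .
qed

lemma simple_integral_right_continuous:
  assumes X: "X \<in> CL M F T" and t: "t \<in> {0..<T}" and \<omega>: "\<omega> \<in> space M"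
  shows "((\<lambda>s. simple_integral D X s \<omega>) \<longlongrightarrow> simple_integral D X t \<omega>) (at_right t)"
proof (cases D)
  case (fields k h0 \<tau> h)
  have c: "cadlag_path T (\<lambda>t. X t \<omega>)" using X \<omega> by (simp add: CL_def)
  show ?thesis
    unfolding fields simple_integral.simps by (intro tendsto_intros cadlag_path_stopped_right[where T=T and X=X and \<omega>=\<omega>] c t)
qed

text \<open>If \<open>H\<^sup>k\<close> and \<open>\<integral> H\<^sup>k dX\<close> are uniformly within \<open>e\<close> of their limits, then the jumps of the limit
  differ from \<open>H \<Delta>X\<close> by at most \<open>e (2 + \<bar>\<Delta>X\<bar>)\<close>. For fixed \<open>e\<close> the exceptional set is contained in
  those of all \<open>k\<close>, hence null; no almost surely convergent subsequence is needed.\<close>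

lemma stochastic_integral_jump:
  assumes "stochastic_integral M F T H X I"
  shows "AE \<omega> in M. \<forall>t\<in>{0<..T}. jump I t \<omega> = H t \<omega> * jump X t \<omega>"
proof -
  obtain D where D: "\<And>k. simple_data M F T (D k)"
    and limH: "ucp_lim M T (\<lambda>k. simple_process (D k)) H"
    and limI: "ucp_lim M T (\<lambda>k. simple_integral (D k) X) I"
    using assms unfolding stochastic_integral_def by blast
  have X: "X \<in> CL M F T" and I: "I \<in> CL M F T"
    and H: "adapted F T H" "\<And>\<omega>. \<omega> \<in> space M \<Longrightarrow> caglad_path T (\<lambda>t. H t \<omega>)"
    using assms by (auto simp: stochastic_integral_def semimartingale_def)
  define U where "U e k = {\<omega>\<in>space M. \<exists>t\<in>{0..T}. e < \<bar>simple_process (D k) t \<omega> - H t \<omega>\<bar>}" for e k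
  define V where "V e k = {\<omega>\<in>space M. \<exists>t\<in>{0..T}. e < \<bar>simple_integral (D k) X t \<omega> - I t \<omega>\<bar>}" for e k
  have U: "U e k \<in> sets M" for e k unfolding U_def
  proof (rule sets_exceedance_event)
    fix t assume "t \<in> {0..T}"
    then have "H t \<in> borel_measurable M" using H(1) measurable_F_M unfolding adapted_def by blast
    then show "(\<lambda>\<omega>. simple_process (D k) t \<omega> - H t \<omega>) \<in> borel_measurable M"
      using simple_process_measurable[OF D] by (intro borel_measurable_diff)
  next
    fix \<omega> t assume \<omega>: "\<omega> \<in> space M" and t: "t \<in> {0<..<T}"
    then have "((\<lambda>s. H s \<omega>) \<longlongrightarrow> H t \<omega>) (at_left t)" using H(2)[OF \<omega>] by (auto simp: caglad_path_def)
    then show "((\<lambda>s. simple_process (D k) s \<omega> - H s \<omega>) \<longlongrightarrow> simple_process (D k) t \<omega> - H t \<omega>) (at_left t)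
       \<or> ((\<lambda>s. simple_process (D k) s \<omega> - H s \<omega>) \<longlongrightarrow> simple_process (D k) t \<omega> - H t \<omega>) (at_right t)"
      using t by (intro disjI1 tendsto_diff simple_process_left_continuous) auto
  qed
  have V: "V e k \<in> sets M" for e k unfolding V_def
  proof (rule sets_exceedance_event)
    fix t assume t: "t \<in> {0..T}"
    then have "I t \<in> borel_measurable M" using I measurable_F_M unfolding CL_def adapted_def by blast
    then show "(\<lambda>\<omega>. simple_integral (D k) X t \<omega> - I t \<omega>) \<in> borel_measurable M"
      using simple_integral_measurable[OF D X t] by (intro borel_measurable_diff)
  next
    fix \<omega> t assume \<omega>: "\<omega> \<in> space M" and t: "t \<in> {0<..<T}"
    then have "((\<lambda>s. I s \<omega>) \<longlongrightarrow> I t \<omega>) (at_right t)" using I by (auto simp: CL_def cadlag_path_def)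
    then show "((\<lambda>s. simple_integral (D k) X s \<omega> - I s \<omega>) \<longlongrightarrow> simple_integral (D k) X t \<omega> - I t \<omega>) (at_left t)
       \<or> ((\<lambda>s. simple_integral (D k) X s \<omega> - I s \<omega>) \<longlongrightarrow> simple_integral (D k) X t \<omega> - I t \<omega>) (at_right t)"
      using t \<omega> by (intro disjI2 tendsto_diff simple_integral_right_continuous[OF X]) auto
  qed
  define N where "N e = (\<Inter>k. U e k \<union> V e k)" for e
  have N: "AE \<omega> in M. \<omega> \<notin> N e" if e: "0 < e" for e
  proof -
    have sets: "N e \<in> sets M" unfolding N_def using U V by auto
    have "measure M (N e) \<le> measure M (U e k) + measure M (V e k)" for k
    proof -
      have "measure M (N e) \<le> measure M (U e k \<union> V e k)"
        using U V by (intro finite_measure_mono) (auto simp: N_def)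
      also have "\<dots> \<le> measure M (U e k) + measure M (V e k)" using U V by (rule measure_Un_le)
      finally show ?thesis .
    qed
    moreover have "(\<lambda>k. measure M (U e k) + measure M (V e k)) \<longlonglongrightarrow> 0 + 0"
      using limH limI e unfolding ucp_lim_def U_def V_def by (intro tendsto_add) auto
    ultimately have "measure M (N e) \<le> 0 + 0"
      by (intro LIMSEQ_le_const[where X="\<lambda>k. measure M (U e k) + measure M (V e k)"]) auto
    then have "N e \<in> null_sets M" using sets by (simp add: null_sets_def emeasure_eq_measure measure_le_0_iff)
    then show ?thesis by (rule AE_not_in)
  qed
  have "AE \<omega> in M. \<forall>j::nat. \<omega> \<notin> N (1 / Suc j)"
    using N by (subst AE_all_countable) simp
  with AE_space show ?thesis
  proof eventually_elim
    case (elim \<omega>)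
    note \<omega> = elim(1)
    show ?case
    proof
      fix t assume t: "t \<in> {0<..T}"
      have IL: "((\<lambda>s. I s \<omega>) \<longlongrightarrow> I t \<omega> - jump I t \<omega>) (at_left t)"
        using cadlag_path_left_limit[of T "\<lambda>s. I s \<omega>", OF _ t] I \<omega> t
        by (auto simp: CL_def jump_def left_limit_def)
      have bound: "\<bar>jump I t \<omega> - H t \<omega> * jump X t \<omega>\<bar> \<le> (2 + \<bar>jump X t \<omega>\<bar>) * (1 / Suc j)" for j :: nat
      proof -
        define e where "e = 1 / real (Suc j)"
        obtain k where k: "\<omega> \<notin> U e k" "\<omega> \<notin> V e k" using elim(2) unfolding N_def e_def by blast
        have u: "\<bar>simple_process (D k) t \<omega> - H t \<omega>\<bar> \<le> e" using k(1) \<omega> t unfolding U_def by (simp add: not_less)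
        have v: "\<bar>simple_integral (D k) X s \<omega> - I s \<omega>\<bar> \<le> e" if "s \<in> {0..T}" for s
          using k(2) \<omega> that unfolding V_def by (simp add: not_less)
        have "((\<lambda>s. \<bar>simple_integral (D k) X s \<omega> - I s \<omega>\<bar>) \<longlongrightarrow>
           \<bar>(simple_integral (D k) X t \<omega> - simple_process (D k) t \<omega> * jump X t \<omega>) - (I t \<omega> - jump I t \<omega>)\<bar>) (at_left t)"
          by (intro tendsto_intros IL simple_integral_left_limit[OF D X t \<omega>])
        moreover have "\<forall>\<^sub>F s in at_left t. \<bar>simple_integral (D k) X s \<omega> - I s \<omega>\<bar> \<le> e"
          using eventually_at_left_real[of 0 t] t v by (auto elim!: eventually_mono)
        ultimately have "\<bar>(simple_integral (D k) X t \<omega> - simple_process (D k) t \<omega> * jump X t \<omega>) - (I t \<omega> - jump I t \<omega>)\<bar> \<le> e"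
          by (rule tendsto_upperbound) simp
        moreover have "\<bar>simple_integral (D k) X t \<omega> - I t \<omega>\<bar> \<le> e" using v t by auto
        \<comment> \<open>The uniform error \<open>e\<close> enters twice, once at \<open>t\<close>
          and once in the left limit.\<close>
        ultimately have "\<bar>jump I t \<omega> - simple_process (D k) t \<omega> * jump X t \<omega>\<bar> \<le> 2 * e" by linarith
        moreover have "\<bar>simple_process (D k) t \<omega> * jump X t \<omega> - H t \<omega> * jump X t \<omega>\<bar> \<le> e * \<bar>jump X t \<omega>\<bar>"
          using mult_right_mono[OF u, of "\<bar>jump X t \<omega>\<bar>"] by (simp add: abs_mult[symmetric] left_diff_distrib)
        ultimately have "\<bar>jump I t \<omega> - H t \<omega> * jump X t \<omega>\<bar> \<le> 2 * e + e * \<bar>jump X t \<omega>\<bar>" by linarith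
        then show ?thesis unfolding e_def[symmetric] by (simp add: algebra_simps)
      qed
      have "(\<lambda>j. (2 + \<bar>jump X t \<omega>\<bar>) * (1 / Suc j)) \<longlonglongrightarrow> (2 + \<bar>jump X t \<omega>\<bar>) * 0"
        using LIMSEQ_inverse_real_of_nat by (intro tendsto_mult tendsto_const) (simp add: inverse_eq_divide)
      then have "\<bar>jump I t \<omega> - H t \<omega> * jump X t \<omega>\<bar> \<le> (2 + \<bar>jump X t \<omega>\<bar>) * 0"
        using bound by (intro LIMSEQ_le_const) auto
      then show "jump I t \<omega> = H t \<omega> * jump X t \<omega>" by simp
    qed
  qed
qed

end


section \<open>Moments of jump counts\<close>

context filtered_prob_space
begin

section \<open>The predictable \<sigma>-algebra\<close>

lemma
  shows space_predictable_sigma: "space (predictable_sigma M F T) = space M \<times> {0..T}"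
    and predictable_rectangle: "\<And>A s. \<lbrakk>0 \<le> s; s < T; A \<in> sets (F s)\<rbrakk> \<Longrightarrow>
      A \<times> {s<..T} \<in> sets (predictable_sigma M F T)"
proof -
  let ?G = "{A \<times> {0} | A. A \<in> sets (F 0)} \<union>
      {A \<times> {s<..t} | A s t. 0 \<le> s \<and> s < t \<and> t \<le> T \<and> A \<in> sets (F s)}"
  have "A \<subseteq> space M" if "A \<in> sets (F s)" for A s
    using sets.sets_into_space[OF that] by (simp add: space_F)
  then have G: "?G \<subseteq> Pow (space M \<times> {0..T})" using T_pos by fastforce
  show "space (predictable_sigma M F T) = space M \<times> {0..T}"
    unfolding predictable_sigma_def by (rule space_measure_of[OF G])
  show "A \<times> {s<..T} \<in> sets (predictable_sigma M F T)" if "0 \<le> s" "s < T" "A \<in> sets (F s)" for A s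
    unfolding predictable_sigma_def sets_measure_of[OF G]
    using that by (intro sigma_sets.Basic UnI2) blast
qed

lemma measurable_snd_predictable_sigma:
  "snd \<in> predictable_sigma M F T \<rightarrow>\<^sub>M restrict_space borel {0..T}"
proof (rule measurable_restrict_space2)
  show "snd \<in> space (predictable_sigma M F T) \<rightarrow> {0..T}" by (auto simp: space_predictable_sigma)
  show "snd \<in> borel_measurable (predictable_sigma M F T)"
  proof (rule borel_measurableI_greater)
    fix y :: real
    have space: "space M \<in> sets (F y)" using sets.top[of "F y"] by (simp add: space_F)
    consider "y < 0" | "T \<le> y" | "0 \<le> y" "y < T" by linarith
    then show "{x \<in> space (predictable_sigma M F T). y < snd x} \<in> sets (predictable_sigma M F T)"
    proof cases
      case 1
      then have "{x \<in> space (predictable_sigma M F T). y < snd x} = space (predictable_sigma M F T)"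
        by (auto simp: space_predictable_sigma)
      then show ?thesis by simp
    next
      case 2
      then have "{x \<in> space (predictable_sigma M F T). y < snd x} = {}"
        by (auto simp: space_predictable_sigma)
      then show ?thesis by (simp del: Collect_empty_eq)
    next
      case 3
      then have "{x \<in> space (predictable_sigma M F T). y < snd x} = space M \<times> {y<..T}"
        by (auto simp: space_predictable_sigma)
      then show ?thesis using predictable_rectangle[OF 3 space] by simp
    qed
  qed
qed

text \<open>Building block of the predictable integrand: information available at \<open>s\<close>,
  used only strictly after \<open>s\<close>. Its superlevel sets are predictable rectangles.\<close>

lemma measurable_predictable_step:
  fixes f :: "'a \<Rightarrow> ennreal"
  assumes f: "f \<in> borel_measurable (F s)" and s: "0 \<le> s" "s < T"
  shows "(\<lambda>x. f (fst x) * indicator {s<..T} (snd x)) \<in> borel_measurable (predictable_sigma M F T)"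
proof (rule borel_measurableI_greater)
  fix y :: ennreal
  have "{\<omega>\<in>space (F s). y < f \<omega>} \<in> sets (F s)" using f by measurable
  moreover have "{x \<in> space (predictable_sigma M F T). y < f (fst x) * indicator {s<..T} (snd x)}
     = {\<omega>\<in>space (F s). y < f \<omega>} \<times> {s<..T}"
    using s by (auto simp: space_predictable_sigma space_F indicator_def split: if_splits)
  ultimately show "{x \<in> space (predictable_sigma M F T). y < f (fst x) * indicator {s<..T} (snd x)}
      \<in> sets (predictable_sigma M F T)"
    using predictable_rectangle[OF s] by simp
qed

section \<open>Integration against the jump measure\<close>

definition big_marks :: "(real \<Rightarrow> real) \<Rightarrow> (real \<times> real) set" where
  "big_marks g = {p \<in> {0..T} \<times> UNIV. g (fst p) < \<bar>snd p\<bar>}"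

lemma sets_big_marks:
  assumes "continuous_on {0..T} g"
  shows "big_marks g \<in> sets (time_mark_space T)"
proof -
  have g: "g \<in> borel_measurable (restrict_space borel {0..T})"
    using assms by (rule borel_measurable_continuous_on_restrict)
  have "{p \<in> space (time_mark_space T). g (fst p) < \<bar>snd p\<bar>} \<in> sets (time_mark_space T)"
    unfolding time_mark_space_def using g by measurable
  then show ?thesis
    by (simp add: big_marks_def time_mark_space_def space_pair_measure space_restrict_space)
qed

text \<open>\<open>jump_measure\<close> records nonzero jumps only; since \<open>g\<close> is
  nonnegative, every jump above \<open>g\<close> is among them.\<close>

lemma nn_integral_jump_measure:
  assumes g: "continuous_on {0..T} g" "\<And>t. t \<in> {0..T} \<Longrightarrow> 0 \<le> g t"
    and h: "h \<in> borel_measurable (restrict_space borel {0..T})"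
  shows "(\<integral>\<^sup>+ (s, z). h s * indicator (big_marks g) (s, z) \<partial>jump_measure T X \<omega>) =
    (\<integral>\<^sup>+ s. h s \<partial>count_space (jump_times T X g \<omega>))"
proof -
  let ?D = "{s\<in>{0<..T}. jump X s \<omega> \<noteq> 0}"
  have m1: "(\<lambda>s. (s, jump X s \<omega>)) \<in> count_space ?D \<rightarrow>\<^sub>M time_mark_space T"
    by (auto simp: time_mark_space_def space_pair_measure space_restrict_space)
  have m2: "(\<lambda>(s, z). h s * indicator (big_marks g) (s, z)) \<in> borel_measurable (time_mark_space T)"
  proof -
    have "(\<lambda>p. h (fst p)) \<in> borel_measurable (time_mark_space T)"
      unfolding time_mark_space_def using h by measurable
    then show ?thesis unfolding case_prod_beta prod.collapse
      using sets_big_marks[OF g(1)] by (intro borel_measurable_times_ennreal borel_measurable_indicator)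
  qed
  have J: "jump_times T X g \<omega> \<subseteq> ?D" 
  proof
    fix s assume s: "s \<in> jump_times T X g \<omega>"
    then have "0 \<le> g s" by (intro g(2)) (auto simp: jump_times_def)
    then show "s \<in> ?D" using s by (auto simp: jump_times_def)
  qed
  have "(\<integral>\<^sup>+ (s, z). h s * indicator (big_marks g) (s, z) \<partial>jump_measure T X \<omega>) =
    (\<integral>\<^sup>+ s. h s * indicator (big_marks g) (s, jump X s \<omega>) \<partial>count_space ?D)"
    unfolding jump_measure_def using m2 by (subst nn_integral_distr[OF m1]) simp_all
  also have "\<dots> = (\<integral>\<^sup>+ s. h s * indicator (jump_times T X g \<omega>) s \<partial>count_space ?D)"
    by (intro nn_integral_cong arg_cong2[where f="(*)"] refl)
      (auto simp: indicator_def big_marks_def jump_times_def)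
  also have "\<dots> = (\<integral>\<^sup>+ s. h s \<partial>count_space (jump_times T X g \<omega>))"
    using J by (subst (1 2) nn_integral_count_space_indicator) (auto intro!: nn_integral_cong simp: indicator_def)
  finally show ?thesis .
qed

text \<open>Both moments come from the compensation formula for \<open>h\<close> times the indicator
  of the big marks: \<open>h = 1\<close> gives the first. For the second, \<open>h\<close> dominates
  the rank summand but is itself at most \<open>2 * N \<omega> + 1\<close>, which is free of time
  and mark; so the pathwise bound \<open>K\<close> applies to the compensator, and the first moment
  finishes the estimate.\<close>

lemma jump_count_moments:
  assumes X: "X \<in> CL M F T" and comp: "is_compensator M F T (jump_measure T X) \<pi>"
    and g: "continuous_on {0..T} g" "\<And>t. t \<in> {0..T} \<Longrightarrow> 0 \<le> g t"
    and K: "AE \<omega> in M. emeasure (\<pi> \<omega>) (big_marks g) \<le> K"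
  defines "N \<equiv> \<lambda>\<omega>. emeasure (count_space UNIV) (jump_times T X g \<omega>)"
  shows "N \<in> borel_measurable M" "(\<integral>\<^sup>+ \<omega>. N \<omega> \<partial>M) \<le> K"
    "K < \<infinity> \<Longrightarrow> (\<integral>\<^sup>+ \<omega>. (N \<omega>)\<^sup>2 \<partial>M) \<le> (2 * K + 1) * K"
proof -
  define B where "B = big_marks g"
  have B: "B \<in> sets (time_mark_space T)" unfolding B_def by (rule sets_big_marks[OF g(1)])
  have B': "B \<in> sets (\<pi> \<omega>)" if "\<omega> \<in> space M" for \<omega>
    using comp that B by (simp add: is_compensator_def predictable_random_measure_def random_measure_def)
  define Nq where "Nq q \<omega> = emeasure (count_space UNIV) (jump_times T X g \<omega> \<inter> {..q})" for q \<omega>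
  have Nq: "Nq q \<in> borel_measurable (F q)" if "0 < q" "q \<le> T" for q
    using measurable_count_jump_times[OF X g that, of "{}"] by (simp add: Nq_def[abs_def])
  have "Nq T = N" by (auto simp: Nq_def N_def jump_times_def intro!: arg_cong[where f="emeasure _"])
  then show N[measurable]: "N \<in> borel_measurable M" using Nq[OF T_pos order_refl] measurable_F_M by simp

  have comp_eq: "(\<integral>\<^sup>+ \<omega>. (\<integral>\<^sup>+ s. h (\<omega>, s) \<partial>count_space (jump_times T X g \<omega>)) \<partial>M) =
     (\<integral>\<^sup>+ \<omega>. (\<integral>\<^sup>+ (s, z). h (\<omega>, s) * indicator B (s, z) \<partial>\<pi> \<omega>) \<partial>M)"
    if h: "h \<in> borel_measurable (predictable_sigma M F T)"
      and h': "\<And>\<omega>. \<omega> \<in> space M \<Longrightarrow> (\<lambda>s. h (\<omega>, s)) \<in> borel_measurable (restrict_space borel {0..T})"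
    for h
  proof -
    define W where "W p = h (fst p) * indicator B (snd (fst p), snd p)" for p
    have "(\<lambda>p. (snd (fst p), snd p)) \<in> predictable_sigma M F T \<Otimes>\<^sub>M borel \<rightarrow>\<^sub>M time_mark_space T"
      unfolding time_mark_space_def
      by (intro measurable_Pair measurable_compose[OF measurable_fst measurable_snd_predictable_sigma] measurable_snd)
    then have "(\<lambda>p. indicator B (snd (fst p), snd p) :: ennreal) \<in> borel_measurable (predictable_sigma M F T \<Otimes>\<^sub>M borel)"
      using B by (intro measurable_compose[OF _ borel_measurable_indicator])
    then have "W \<in> predictable_fun M F T"
      unfolding predictable_fun_def W_def using h by (intro borel_measurable_times_ennreal measurable_compose[OF measurable_fst])
    then have "(\<integral>\<^sup>+ \<omega>. (\<integral>\<^sup>+ (s, z). W ((\<omega>, s), z) \<partial>jump_measure T X \<omega>) \<partial>M) =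
        (\<integral>\<^sup>+ \<omega>. (\<integral>\<^sup>+ (s, z). W ((\<omega>, s), z) \<partial>\<pi> \<omega>) \<partial>M)"
      using comp unfolding is_compensator_def by blast
    moreover have "(\<integral>\<^sup>+ (s, z). W ((\<omega>, s), z) \<partial>jump_measure T X \<omega>) = (\<integral>\<^sup>+ s. h (\<omega>, s) \<partial>count_space (jump_times T X g \<omega>))"
      if "\<omega> \<in> space M" for \<omega>
      using nn_integral_jump_measure[OF g h'[OF that]] by (simp add: W_def B_def)
    ultimately show ?thesis by (simp add: W_def cong: nn_integral_cong)
  qed

  show EN: "(\<integral>\<^sup>+ \<omega>. N \<omega> \<partial>M) \<le> K"
  proof -
    have "(\<integral>\<^sup>+ \<omega>. N \<omega> \<partial>M) = (\<integral>\<^sup>+ \<omega>. (\<integral>\<^sup>+ s. 1 \<partial>count_space (jump_times T X g \<omega>)) \<partial>M)"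
      by (intro nn_integral_cong) (simp add: N_def emeasure_count_space)
    also have "\<dots> = (\<integral>\<^sup>+ \<omega>. (\<integral>\<^sup>+ (s, z). 1 * indicator B (s, z) \<partial>\<pi> \<omega>) \<partial>M)"
      by (rule comp_eq) auto
    also have "\<dots> = (\<integral>\<^sup>+ \<omega>. emeasure (\<pi> \<omega>) B \<partial>M)"
      using B' by (intro nn_integral_cong) (simp add: case_prod_beta)
    also have "\<dots> \<le> (\<integral>\<^sup>+ \<omega>. K \<partial>M)" using K by (intro nn_integral_mono_AE) (simp add: B_def)
    also have "\<dots> = K" by (simp add: emeasure_space_1)
    finally show ?thesis .
  qed

  show "(\<integral>\<^sup>+ \<omega>. (N \<omega>)\<^sup>2 \<partial>M) \<le> (2 * K + 1) * K" if "K < \<infinity>"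
  proof -
    define Q where "Q = {0<..<T} \<inter> \<rat>"
    have Q: "countable Q" unfolding Q_def by (intro countable_Int2 countable_rat)
    \<comment> \<open>At time \<open>s\<close> the supremum counts the jumps strictly before
      \<open>s\<close>. Writing it with rational \<open>q < s\<close> exhibits it as a countable
      supremum of predictable steps.\<close>
    define h where "h x = 2 * (SUP q\<in>Q. Nq q (fst x) * indicator {q<..T} (snd x)) + 1" for x :: "'a \<times> real"
    have h: "h \<in> borel_measurable (predictable_sigma M F T)"
      unfolding h_def using Q Nq
      by (intro borel_measurable_add borel_measurable_const borel_measurable_times_ennreal
          borel_measurable_SUP measurable_predictable_step) (auto simp: Q_def)
    have h': "(\<lambda>s. h (\<omega>, s)) \<in> borel_measurable (restrict_space borel {0..T})" for \<omega>
      unfolding h_def fst_conv snd_conv using Q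
      by (intro borel_measurable_add borel_measurable_const borel_measurable_times_ennreal
          borel_measurable_SUP measurable_restrict_space1 borel_measurable_indicator) auto
    have h_le: "h (\<omega>, s) \<le> 2 * N \<omega> + 1" for \<omega> s
    proof -
      have "Nq q \<omega> * indicator {q<..T} s \<le> N \<omega>" for q
        by (auto simp: Nq_def N_def indicator_def intro!: emeasure_mono)
      then show ?thesis unfolding h_def fst_conv snd_conv
        by (intro add_right_mono mult_left_mono SUP_least) auto
    qed
    have sq: "(N \<omega>)\<^sup>2 \<le> (\<integral>\<^sup>+ s. h (\<omega>, s) \<partial>count_space (jump_times T X g \<omega>))" if fin: "N \<omega> < \<infinity>" for \<omega>
    proof -
      define J where "J = jump_times T X g \<omega>"
      have J: "finite J" using fin by (auto simp: N_def J_def emeasure_count_space split: if_splits)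
      have "of_nat (2 * card {u\<in>J. u < s} + 1) \<le> h (\<omega>, s)" if s: "s \<in> J" for s
      proof -
        have s': "0 < s" "s \<le> T" using s by (auto simp: J_def jump_times_def)
        \<comment> \<open>Last jump time before \<open>s\<close>, or 0 if there is none. A rational
          between \<open>m\<close> and \<open>s\<close> is then positive and already sees all
          earlier jumps.\<close>
        define m where "m = Max (insert 0 {u\<in>J. u < s})"
        have m: "finite (insert 0 {u\<in>J. u < s})" using J by simp
        have "m < s" unfolding m_def using m s' by (subst Max_less_iff) auto
        then obtain q where q: "q \<in> \<rat>" "m < q" "q < s" using Rats_dense_in_real by blast
        have "0 \<le> m" unfolding m_def using m by (intro Max_ge) auto
        then have "q \<in> Q" using q s' by (auto simp: Q_def)
        have "{u\<in>J. u < s} \<subseteq> J \<inter> {..q}"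
        proof
          fix u assume u: "u \<in> {u\<in>J. u < s}"
          then have "u \<le> m" unfolding m_def using m by (intro Max_ge) auto
          then show "u \<in> J \<inter> {..q}" using u q by auto
        qed
        then have "of_nat (card {u\<in>J. u < s}) \<le> Nq q \<omega> * indicator {q<..T} s"
          using J q s' unfolding Nq_def J_def[symmetric] by (simp add: emeasure_count_space_finite card_mono)
        also have "\<dots> \<le> (SUP q\<in>Q. Nq q \<omega> * indicator {q<..T} s)" using \<open>q \<in> Q\<close> by (rule SUP_upper)
        finally have "2 * of_nat (card {u\<in>J. u < s}) + 1 \<le> h (\<omega>, s)"
          unfolding h_def fst_conv snd_conv by (intro add_right_mono mult_left_mono) auto
        then show ?thesis by (simp add: add.commute)
      qed
      then have "(\<Sum>s\<in>J. of_nat (2 * card {u\<in>J. u < s} + 1)) \<le> (\<Sum>s\<in>J. h (\<omega>, s))" by (rule sum_mono)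
      moreover have "(\<Sum>s\<in>J. of_nat (2 * card {u\<in>J. u < s} + 1)) = (of_nat (card J) :: ennreal)\<^sup>2"
        unfolding of_nat_sum[symmetric] sum_rank_eq_square[OF J] by simp
      ultimately show ?thesis
        using J by (simp add: N_def J_def[symmetric] emeasure_count_space_finite nn_integral_count_space_finite)
    qed
    \<comment> \<open>The square formula is available for finite sets only; the first moment
      supplies this almost surely.\<close>
    have "AE \<omega> in M. N \<omega> \<noteq> \<infinity>"
      using EN that by (intro nn_integral_PInf_AE) auto
    then have "(\<integral>\<^sup>+ \<omega>. (N \<omega>)\<^sup>2 \<partial>M) \<le> (\<integral>\<^sup>+ \<omega>. (\<integral>\<^sup>+ s. h (\<omega>, s) \<partial>count_space (jump_times T X g \<omega>)) \<partial>M)"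
      by (intro nn_integral_mono_AE) (auto elim!: eventually_mono intro!: sq simp: less_top)
    also have "\<dots> = (\<integral>\<^sup>+ \<omega>. (\<integral>\<^sup>+ (s, z). h (\<omega>, s) * indicator B (s, z) \<partial>\<pi> \<omega>) \<partial>M)"
      by (rule comp_eq[OF h h'])
    also have "\<dots> \<le> (\<integral>\<^sup>+ \<omega>. (2 * N \<omega> + 1) * K \<partial>M)"
    proof (rule nn_integral_mono_AE, use K AE_space in eventually_elim)
      case (elim \<omega>)
      have "(\<integral>\<^sup>+ (s, z). h (\<omega>, s) * indicator B (s, z) \<partial>\<pi> \<omega>) \<le> (\<integral>\<^sup>+ p. (2 * N \<omega> + 1) * indicator B p \<partial>\<pi> \<omega>)"
        using h_le by (intro nn_integral_mono) (auto intro!: mult_right_mono)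
      also have "\<dots> = (2 * N \<omega> + 1) * emeasure (\<pi> \<omega>) B" using B'[OF elim(2)] by (rule nn_integral_cmult_indicator)
      also have "\<dots> \<le> (2 * N \<omega> + 1) * K" using elim by (intro mult_left_mono) (auto simp: B_def)
      finally show ?case .
    qed
    also have "\<dots> = (2 * (\<integral>\<^sup>+ \<omega>. N \<omega> \<partial>M) + 1) * K"
      by (simp add: nn_integral_multc nn_integral_add nn_integral_cmult emeasure_space_1)
    also have "\<dots> \<le> (2 * K + 1) * K" using EN by (intro mult_right_mono add_right_mono mult_left_mono) auto
    finally show ?thesis .
  qed
qed

end


section \<open>Bounds on the compensator\<close>

lemma Lp_norm_top_AE_le:
  assumes "Lp_norm M \<infinity> f \<le> C" "C < \<infinity>"
  shows "AE x in M. f x \<le> C"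
proof -
  have "esssup M f \<le> C" using assms by (auto simp: Lp_norm_def split: if_splits)
  with esssup_AE[of f M] show ?thesis by (auto elim!: eventually_mono intro: order_trans)
qed

lemma sigma_finite_time_space: "sigma_finite_measure (time_space T)"
  unfolding time_space_def by (rule sigma_finite_measure_restrict_space) (simp_all add: sigma_finite_lborel)

lemma nn_integral_powr_to_end:
  fixes p T :: real
  assumes p: "p < 1" and T: "0 \<le> T"
  shows "(\<integral>\<^sup>+ t. ennreal ((T - t) powr (- p)) \<partial>time_space T) = ennreal (T powr (1 - p) / (1 - p))"
proof -
  have "((\<lambda>x. x powr (- p)) has_integral (T powr (- p + 1) / (- p + 1))) {0..T}"
    using p T by (intro has_integral_powr_from_0) auto
  then have 1: "(\<integral>\<^sup>+ x. ennreal (indicator {0..T} x * x powr (- p)) \<partial>lborel) = ennreal (T powr (- p + 1) / (- p + 1))"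
    by (intro nn_integral_has_integral_lebesgue) auto
  \<comment> \<open>Reflecting time at \<open>T\<close> moves the possible singularity from
    \<open>T\<close> to 0.\<close>
  have "(\<integral>\<^sup>+ x. ennreal (indicator {0..T} x * x powr (- p)) \<partial>lborel) =
     (\<integral>\<^sup>+ t. ennreal (indicator {0..T} (T + (-1) * t) * (T + (-1) * t) powr (- p)) \<partial>lborel)"
    by (subst nn_integral_real_affine[where c="-1" and t=T]) auto
  also have "\<dots> = (\<integral>\<^sup>+ t. ennreal ((T - t) powr (- p)) * indicator {0..T} t \<partial>lborel)"
    by (intro nn_integral_cong) (auto simp: indicator_def)
  also have "\<dots> = (\<integral>\<^sup>+ t. ennreal ((T - t) powr (- p)) \<partial>time_space T)"
    unfolding time_space_def by (subst nn_integral_restrict_space) auto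
  finally show ?thesis using 1 by (simp add: add.commute)
qed

lemma continuous_on_npow:
  assumes "0 \<le> \<kappa>"
  shows "continuous_on {0..T} (\<lambda>t. \<epsilon> * npow (T - t) \<kappa>)"
proof (cases "\<kappa> = 0")
  case False
  then show ?thesis unfolding npow_def using assms
    by (auto intro!: continuous_intros continuous_on_powr')
qed (simp add: npow_def)

section \<open>Tails of the jump kernel and mass of the big marks\<close>

context driving_process
begin

text \<open>The hypothesis gives a separate exceptional set for each radius, whereas here one set
  must serve all \<open>d\<close>. Therefore only rational radii are combined, and a general
  \<open>d < 1\<close> borrows a rational one from (d/2, d), at the price of the factor
  \<open>2 powr \<alpha>\<close>. Marks beyond 1, which the hypothesis does not see, are controlled
  by the second moment of the kernel as in Chebyshev's inequality.\<close>

lemma levy_tail_bound: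
  assumes \<alpha>: "0 < \<alpha>"
    and small_jumps: "(SUP r\<in>{0<..<1}. Lp_norm (M \<Otimes>\<^sub>M time_space T) \<infinity>
          (\<lambda>(\<omega>, t). ennreal (r powr \<alpha>) * emeasure (\<nu> t \<omega>) {z. r < \<bar>z\<bar> \<and> \<bar>z\<bar> \<le> 1})) < \<infinity>"
  obtains C :: real where "0 \<le> C"
    "AE \<omega> in M. AE t in time_space T. \<forall>d>0. emeasure (\<nu> t \<omega>) {z. d < \<bar>z\<bar>} \<le> ennreal (C * (d powr (-\<alpha>) + 1))"
proof -
  interpret time: pair_sigma_finite M "time_space T"
    by (intro pair_sigma_finite.intro sigma_finite_measure_axioms sigma_finite_time_space)
  define C1 where "C1 = (SUP r\<in>{0<..<1}. Lp_norm (M \<Otimes>\<^sub>M time_space T) \<infinity>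
          (\<lambda>(\<omega>, t). ennreal (r powr \<alpha>) * emeasure (\<nu> t \<omega>) {z. r < \<bar>z\<bar> \<and> \<bar>z\<bar> \<le> 1}))"
  define C2 where "C2 = Lp_norm (M \<Otimes>\<^sub>M time_space T) \<infinity> (\<lambda>(\<omega>, t). \<integral>\<^sup>+ z. ennreal (z\<^sup>2) \<partial>\<nu> t \<omega>)"
  have fin: "C1 < \<infinity>" "C2 < \<infinity>" using small_jumps \<nu>_bounded by (auto simp: C1_def C2_def)
  define c1 c2 where "c1 = enn2real C1" and "c2 = enn2real C2"
  have C12: "C1 = ennreal c1" "C2 = ennreal c2" "0 \<le> c1" "0 \<le> c2" using fin by (auto simp: c1_def c2_def less_top)
  define Q where "Q = {0<..<1} \<inter> (\<rat> :: real set)"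
  have Q: "countable Q" unfolding Q_def by (intro countable_Int2 countable_rat)
  have "AE x in M \<Otimes>\<^sub>M time_space T. \<forall>r\<in>Q.
     (case x of (\<omega>, t) \<Rightarrow> ennreal (r powr \<alpha>) * emeasure (\<nu> t \<omega>) {z. r < \<bar>z\<bar> \<and> \<bar>z\<bar> \<le> 1}) \<le> C1"
    using fin(1)
    by (subst AE_ball_countable[OF Q]) (auto intro!: Lp_norm_top_AE_le SUP_upper simp: C1_def Q_def)
  moreover have "AE x in M \<Otimes>\<^sub>M time_space T. (case x of (\<omega>, t) \<Rightarrow> \<integral>\<^sup>+ z. ennreal (z\<^sup>2) \<partial>\<nu> t \<omega>) \<le> C2"
    using fin(2) by (intro Lp_norm_top_AE_le) (simp_all add: C2_def)
  ultimately have "AE x in M \<Otimes>\<^sub>M time_space T. (\<forall>r\<in>Q.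
     (case x of (\<omega>, t) \<Rightarrow> ennreal (r powr \<alpha>) * emeasure (\<nu> t \<omega>) {z. r < \<bar>z\<bar> \<and> \<bar>z\<bar> \<le> 1}) \<le> C1) \<and>
     (case x of (\<omega>, t) \<Rightarrow> \<integral>\<^sup>+ z. ennreal (z\<^sup>2) \<partial>\<nu> t \<omega>) \<le> C2"
    by eventually_elim auto
  from time.AE_pair[OF this]
  have "AE \<omega> in M. AE t in time_space T. (\<forall>r\<in>Q. ennreal (r powr \<alpha>) * emeasure (\<nu> t \<omega>) {z. r < \<bar>z\<bar> \<and> \<bar>z\<bar> \<le> 1} \<le> C1) \<and>
     (\<integral>\<^sup>+ z. ennreal (z\<^sup>2) \<partial>\<nu> t \<omega>) \<le> C2" by simp
  with AE_space
  have "AE \<omega> in M. AE t in time_space T. \<forall>d>0. emeasure (\<nu> t \<omega>) {z. d < \<bar>z\<bar>} \<le> ennreal ((2 powr \<alpha> * c1 + c2) * (d powr (-\<alpha>) + 1))"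
  proof eventually_elim
    case (elim \<omega>)
    from elim(2) AE_space[of "time_space T"] show ?case
    proof eventually_elim
      case (elim t)
      have "t \<in> {0..T}" using elim by (simp add: time_space_def space_restrict_space)
      then have sets: "sets (\<nu> t \<omega>) = sets borel"
        using \<nu>_kernel \<open>\<omega> \<in> space M\<close> by (simp add: levy_kernel_def levy_measure_def)
      have meas: "{z. d < \<bar>z\<bar>} \<in> sets (\<nu> t \<omega>)" "{z. d < \<bar>z\<bar> \<and> \<bar>z\<bar> \<le> 1} \<in> sets (\<nu> t \<omega>)" for d
        unfolding sets by measurable
      have big: "emeasure (\<nu> t \<omega>) {z. 1 < \<bar>z\<bar>} \<le> ennreal c2"
      proof -
        have "emeasure (\<nu> t \<omega>) {z. 1 < \<bar>z\<bar>} = (\<integral>\<^sup>+ z. indicator {z. 1 < \<bar>z\<bar>} z \<partial>\<nu> t \<omega>)"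
          using meas by (subst nn_integral_indicator) auto
        also have "\<dots> \<le> (\<integral>\<^sup>+ z. ennreal (z\<^sup>2) \<partial>\<nu> t \<omega>)"
        proof (intro nn_integral_mono)
          fix z :: real
          show "indicator {z. 1 < \<bar>z\<bar>} z \<le> ennreal (z\<^sup>2)"
          proof (cases "1 < \<bar>z\<bar>")
            case True
            then have "1 \<le> z\<^sup>2" by (metis one_power2 abs_le_square_iff abs_one less_imp_le)
            then show ?thesis using True by (simp add: ennreal_1[symmetric] ennreal_leI del: ennreal_1)
          qed simp
        qed
        also have "\<dots> \<le> ennreal c2" using elim C12 by simp
        finally show ?thesis .
      qed
      show ?case
      proof (intro allI impI)
        fix d :: real assume d: "0 < d"
        show "emeasure (\<nu> t \<omega>) {z. d < \<bar>z\<bar>} \<le> ennreal ((2 powr \<alpha> * c1 + c2) * (d powr (-\<alpha>) + 1))"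
        proof (cases "1 \<le> d")
          case True
          then have "emeasure (\<nu> t \<omega>) {z. d < \<bar>z\<bar>} \<le> emeasure (\<nu> t \<omega>) {z. 1 < \<bar>z\<bar>}"
            using meas by (intro emeasure_mono) auto
          also note big
          \<comment> \<open>For \<open>d \<ge> 1\<close> only the large marks matter; the summand 1
            next to \<open>d powr (-\<alpha>)\<close> is there to absorb \<open>c2\<close>.\<close>
          also have "c2 \<le> (2 powr \<alpha> * c1 + c2) * (d powr (-\<alpha>) + 1)"
            using C12 mult_mono[of c2 "2 powr \<alpha> * c1 + c2" 1 "d powr (-\<alpha>) + 1"] by simp
          finally show ?thesis by (simp add: ennreal_leI)
        next
          case False
          obtain r where r: "r \<in> \<rat>" "d / 2 < r" "r < d" using Rats_dense_in_real[of "d/2" d] d by auto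
          then have rQ: "r \<in> Q" and r0: "0 < r" using d False by (auto simp: Q_def)
          define m where "m = emeasure (\<nu> t \<omega>) {z. r < \<bar>z\<bar> \<and> \<bar>z\<bar> \<le> 1}"
          have "ennreal (r powr \<alpha>) * m \<le> ennreal c1" using elim rQ C12 by (simp add: m_def)
          then have "ennreal (r powr (-\<alpha>)) * (ennreal (r powr \<alpha>) * m) \<le> ennreal (r powr (-\<alpha>)) * ennreal c1"
            by (rule mult_left_mono) simp
          moreover have "ennreal (r powr (-\<alpha>)) * (ennreal (r powr \<alpha>) * m) = m"
            using r0 by (simp add: mult.assoc[symmetric] ennreal_mult'[symmetric] powr_add[symmetric])
          ultimately have m: "m \<le> ennreal (r powr (-\<alpha>) * c1)" by (simp add: ennreal_mult')
          have "r powr (-\<alpha>) \<le> (d/2) powr (-\<alpha>)"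
            using r r0 d \<alpha> by (intro powr_mono2') auto
          also have "(d/2) powr (-\<alpha>) = 2 powr \<alpha> * d powr (-\<alpha>)"
            using d by (simp add: powr_divide powr_minus field_simps)
          finally have rd: "r powr (-\<alpha>) * c1 \<le> 2 powr \<alpha> * d powr (-\<alpha>) * c1"
            using C12 by (intro mult_right_mono)
          have "emeasure (\<nu> t \<omega>) {z. d < \<bar>z\<bar>} \<le> emeasure (\<nu> t \<omega>) ({z. r < \<bar>z\<bar> \<and> \<bar>z\<bar> \<le> 1} \<union> {z. 1 < \<bar>z\<bar>})"
            using r meas by (intro emeasure_mono sets.Un) auto
          also have "\<dots> \<le> m + emeasure (\<nu> t \<omega>) {z. 1 < \<bar>z\<bar>}"
            unfolding m_def using meas by (intro emeasure_subadditive) auto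
          also have "\<dots> \<le> ennreal (r powr (-\<alpha>) * c1) + ennreal c2" by (rule add_mono[OF m big])
          also have "\<dots> = ennreal (r powr (-\<alpha>) * c1 + c2)" using C12 by simp
          also have "\<dots> \<le> ennreal ((2 powr \<alpha> * c1 + c2) * (d powr (-\<alpha>) + 1))"
          proof (rule ennreal_leI)
            have "0 \<le> c2 * d powr (-\<alpha>)" "0 \<le> 2 powr \<alpha> * c1" using C12 by auto
            then show "r powr (-\<alpha>) * c1 + c2 \<le> (2 powr \<alpha> * c1 + c2) * (d powr (-\<alpha>) + 1)"
              using rd by (simp add: algebra_simps)
          qed
          finally show ?thesis .
        qed
      qed
    qed
  qed
  moreover have "0 \<le> 2 powr \<alpha> * c1 + c2" using C12 by simp
  ultimately show ?thesis using that by blast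
qed

lemma compensator_big_marks_bound:
  assumes \<alpha>: "0 < \<alpha>" and \<kappa>: "0 \<le> \<kappa>" "\<kappa> * \<alpha> < 1"
    and small_jumps: "(SUP r\<in>{0<..<1}. Lp_norm (M \<Otimes>\<^sub>M time_space T) \<infinity>
          (\<lambda>(\<omega>, t). ennreal (r powr \<alpha>) * emeasure (\<nu> t \<omega>) {z. r < \<bar>z\<bar> \<and> \<bar>z\<bar> \<le> 1})) < \<infinity>"
  obtains K :: real where "0 \<le> K"
    "\<And>\<epsilon>. 0 < \<epsilon> \<Longrightarrow> AE \<omega> in M. emeasure (\<pi>Z \<omega>) (big_marks (\<lambda>t. \<epsilon> * npow (T - t) \<kappa>)) \<le> ennreal (K * (\<epsilon> powr (-\<alpha>) + 1))"
proof -
  obtain C where C: "0 \<le> C"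
    "AE \<omega> in M. AE t in time_space T. \<forall>d>0. emeasure (\<nu> t \<omega>) {z. d < \<bar>z\<bar>} \<le> ennreal (C * (d powr (-\<alpha>) + 1))"
    by (rule levy_tail_bound[OF \<alpha> small_jumps])
  define p where "p = \<kappa> * \<alpha>"
  define I where "I = T powr (1 - p) / (1 - p)"
  have I: "0 \<le> I" using \<kappa> by (simp add: I_def p_def)
  \<comment> \<open>At \<open>t = T\<close> the threshold vanishes when \<kappa> > 0, while the tail
    bound requires \<open>d > 0\<close>; a single time is negligible.\<close>
  have not_T: "AE t in time_space T. t \<noteq> T"
    unfolding time_space_def using AE_lborel_singleton[of T] by (subst AE_restrict_space_iff) auto
  \<comment> \<open>The time integral is at most
    \<open>C * \<epsilon> powr (-\<alpha>) * I + C * T\<close>, where \<open>I\<close> integrates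
    the singular factor; enlarging both coefficients to \<open>C * (I + T)\<close> gives a constant
    independent of \<epsilon>.\<close>
  show ?thesis
  proof (rule that[of "C * (I + T)"])
    show "0 \<le> C * (I + T)" using C I T_pos by simp
    fix \<epsilon> :: real assume \<epsilon>: "0 < \<epsilon>"
    define g where "g t = \<epsilon> * npow (T - t) \<kappa>" for t
    have cont: "continuous_on {0..T} g" unfolding g_def by (rule continuous_on_npow[OF \<kappa>(1)])
    have B: "big_marks g \<in> sets (time_mark_space T)" by (rule sets_big_marks[OF cont])
    from C(2) AE_space show "AE \<omega> in M. emeasure (\<pi>Z \<omega>) (big_marks (\<lambda>t. \<epsilon> * npow (T - t) \<kappa>)) \<le> ennreal (C * (I + T) * (\<epsilon> powr (-\<alpha>) + 1))"
    proof eventually_elim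
      case (elim \<omega>)
      have "emeasure (\<pi>Z \<omega>) (big_marks g) = (\<integral>\<^sup>+ t. emeasure (\<nu> t \<omega>) {z. (t, z) \<in> big_marks g} \<partial>time_space T)"
        by (rule \<pi>Z_density[OF elim(2) B])
      also have "\<dots> \<le> (\<integral>\<^sup>+ t. ennreal (C * \<epsilon> powr (-\<alpha>)) * ennreal ((T - t) powr (-p)) + ennreal C \<partial>time_space T)"
      proof (rule nn_integral_mono_AE, use elim(1) not_T AE_space in eventually_elim)
        case (elim t)
        then have t: "0 \<le> t" "t < T" by (auto simp: time_space_def space_restrict_space)
        then have g: "g t = \<epsilon> * (T - t) powr \<kappa>" by (simp add: g_def npow_def)
        then have g0: "0 < g t" using \<epsilon> t by simp
        have "{z. (t, z) \<in> big_marks g} = {z. g t < \<bar>z\<bar>}" using t by (auto simp: big_marks_def)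
        then have "emeasure (\<nu> t \<omega>) {z. (t, z) \<in> big_marks g} \<le> ennreal (C * (g t powr (-\<alpha>) + 1))"
          using elim(1) g0 by simp
        also have "g t powr (-\<alpha>) = \<epsilon> powr (-\<alpha>) * (T - t) powr (-p)"
          unfolding g p_def using \<epsilon> t by (simp add: powr_mult powr_powr)
        also have "ennreal (C * (\<epsilon> powr (-\<alpha>) * (T - t) powr (-p) + 1)) =
           ennreal (C * \<epsilon> powr (-\<alpha>)) * ennreal ((T - t) powr (-p)) + ennreal C"
          using C by (simp add: distrib_left ennreal_mult[symmetric] mult.assoc)
        finally show ?case .
      qed
      also have "\<dots> = ennreal (C * \<epsilon> powr (-\<alpha>)) * ennreal I + ennreal C * ennreal T"
      proof -
        have m: "(\<lambda>t. ennreal ((T - t) powr (-p))) \<in> borel_measurable (time_space T)"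
          unfolding time_space_def by (intro measurable_restrict_space1) measurable
        have sp: "emeasure (time_space T) (space (time_space T)) = ennreal T"
          using T_pos unfolding time_space_def by (simp add: emeasure_restrict_space space_restrict_space)
        have "p < 1" using \<kappa> by (simp add: p_def)
        then show ?thesis using T_pos m
          by (simp add: nn_integral_add nn_integral_cmult nn_integral_powr_to_end I_def sp)
      qed
      also have "\<dots> = ennreal (C * \<epsilon> powr (-\<alpha>) * I + C * T)"
        using C I T_pos by (simp add: ennreal_mult[symmetric])
      also have "\<dots> \<le> ennreal (C * (I + T) * (\<epsilon> powr (-\<alpha>) + 1))"
      proof (rule ennreal_leI)
        have "0 \<le> C * I" "0 \<le> C * T * \<epsilon> powr (-\<alpha>)" using C I T_pos by auto
        then show "C * \<epsilon> powr (-\<alpha>) * I + C * T \<le> C * (I + T) * (\<epsilon> powr (-\<alpha>) + 1)"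
          by (simp add: algebra_simps)
      qed
      finally show ?case unfolding g_def .
    qed
  qed
qed

end


section \<open>Change of measure and the main estimate\<close>

text \<open>Needed because the knot count built from \<open>S\<close> agrees only almost surely with
  the count built from \<open>Z\<close>, whose measurability is known. Completeness makes the
  exceptional set harmless.\<close>

lemma (in complete_measure) measurable_AE_eq:
  assumes f: "f \<in> M \<rightarrow>\<^sub>M N" and eq: "AE x in M. f x = g x" and g: "g \<in> space M \<rightarrow> space N"
  shows "g \<in> M \<rightarrow>\<^sub>M N"
proof (rule measurableI)
  show "g x \<in> space N" if "x \<in> space M" for x using g that by auto
  fix A assume A: "A \<in> sets N"
  show "g -` A \<inter> space M \<in> sets M"
  proof (rule in_sets_AE)
    show "AE x in M. x \<in> f -` A \<inter> space M \<longleftrightarrow> x \<in> g -` A \<inter> space M" using eq by eventually_elim auto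
    show "f -` A \<inter> space M \<in> sets M" using f A by (rule measurable_sets)
  qed auto
qed

section \<open>Powers on the extended half-line and the density estimate\<close>

lemma ennpowr_mono: "x \<le> y \<Longrightarrow> 0 \<le> p \<Longrightarrow> ennpowr x p \<le> ennpowr y p"
  by (auto simp: ennpowr_def top_unique less_top intro!: ennreal_leI powr_mono2 enn2real_mono)

lemma ennpowr_ennreal: "0 \<le> x \<Longrightarrow> ennpowr (ennreal x) p = ennreal (x powr p)"
  by (simp add: ennpowr_def)

lemma ennpowr_2: "ennpowr x 2 = x\<^sup>2"
  by (cases x) (simp_all add: ennpowr_def ennreal_power[symmetric] power_top_ennreal)

lemma measurable_ennpowr:
  assumes [measurable]: "f \<in> borel_measurable M"
  shows "(\<lambda>x. ennpowr (f x) p) \<in> borel_measurable M"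
  unfolding ennpowr_def by measurable

lemma square_add_le_ennreal:
  fixes x y :: ennreal
  shows "(x + y)\<^sup>2 \<le> 2 * (x\<^sup>2 + y\<^sup>2)"
proof (cases x; cases y)
  fix a b assume xy: "x = ennreal a" "y = ennreal b" "0 \<le> a" "0 \<le> b"
  have "(a + b)\<^sup>2 \<le> 2 * (a\<^sup>2 + b\<^sup>2)" using sum_squares_bound[of a b] by (simp add: power2_eq_square algebra_simps)
  then have "ennreal ((a + b)\<^sup>2) \<le> ennreal (2 * (a\<^sup>2 + b\<^sup>2))" by (rule ennreal_leI)
  moreover have "ennreal ((a + b)\<^sup>2) = (x + y)\<^sup>2" using xy by (simp add: ennreal_power[symmetric])
  moreover have "ennreal (2 * (a\<^sup>2 + b\<^sup>2)) = 2 * (x\<^sup>2 + y\<^sup>2)" using xy by (simp add: ennreal_power ennreal_mult')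
  ultimately show ?thesis by simp
qed (simp_all add: power_top_ennreal ennreal_mult_top)

text \<open>Instead of Hoelder's inequality, Young's inequality is applied pointwise to \<open>D\<close> and \<open>(x / n)\<^sup>q\<close>.\<close>

lemma density_moment_bound:
  fixes D :: "'a \<Rightarrow> ennreal" and q :: real and r :: ennreal
  assumes D[measurable]: "D \<in> borel_measurable M" and fin: "Lp_norm M r D < \<infinity>"
    and q: "1 \<le> q" "q \<le> 2" and r: "2 \<le> r" and qr: "ennreal (q / 2) + 1 / r = 1"
  obtains G :: real where "0 \<le> G"
    "\<And>x n A. \<lbrakk>x \<in> borel_measurable M; 0 < n; 0 \<le> A; (\<integral>\<^sup>+ \<omega>. (x \<omega>)\<^sup>2 \<partial>M) \<le> ennreal (A * n\<^sup>2)\<rbrakk> \<Longrightarrow>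
       (\<integral>\<^sup>+ \<omega>. D \<omega> * ennpowr (x \<omega>) q \<partial>M) \<le> ennreal (G * (1 + A) * n powr q)"
proof (cases r)
  case top
  \<comment> \<open>Here \<open>1 / r\<close> is 0, so the exponent relation forces
    \<open>q = 2\<close> and the essentially bounded density can be pulled out.\<close>
  then have "ennreal (q / 2) = 1" using qr by simp
  then have q2: "q = 2" using q by (simp add: ennreal_eq_1)
  define G where "G = enn2real (Lp_norm M r D)"
  have G: "Lp_norm M r D = ennreal G" "0 \<le> G" using fin by (auto simp: G_def less_top)
  then have DG: "AE \<omega> in M. D \<omega> \<le> ennreal G" using top by (intro Lp_norm_top_AE_le) auto
  show ?thesis
  proof (rule that[OF G(2)])
    fix x :: "'a \<Rightarrow> ennreal" and n A :: real
    assume x[measurable]: "x \<in> borel_measurable M" and n: "0 < n" and A: "0 \<le> A" "(\<integral>\<^sup>+ \<omega>. (x \<omega>)\<^sup>2 \<partial>M) \<le> ennreal (A * n\<^sup>2)"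
    have "(\<integral>\<^sup>+ \<omega>. D \<omega> * ennpowr (x \<omega>) q \<partial>M) \<le> (\<integral>\<^sup>+ \<omega>. ennreal G * (x \<omega>)\<^sup>2 \<partial>M)"
      unfolding q2 ennpowr_2 using DG by (intro nn_integral_mono_AE) (auto elim!: eventually_mono intro: mult_right_mono)
    also have "\<dots> = ennreal G * (\<integral>\<^sup>+ \<omega>. (x \<omega>)\<^sup>2 \<partial>M)" by (rule nn_integral_cmult) measurable
    also have "\<dots> \<le> ennreal G * ennreal (A * n\<^sup>2)" using A(2) by (rule mult_left_mono) simp
    also have "\<dots> = ennreal (G * (A * n\<^sup>2))" using G A by (simp add: ennreal_mult')
    also have "\<dots> \<le> ennreal (G * (1 + A) * n powr q)"
      using G A n unfolding q2 by (intro ennreal_leI) (simp add: algebra_simps)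
    finally show "(\<integral>\<^sup>+ \<omega>. D \<omega> * ennpowr (x \<omega>) q \<partial>M) \<le> ennreal (G * (1 + A) * n powr q)" .
  qed
next
  case (real \<rho>)
  have \<rho>: "2 \<le> \<rho>" using r real by (simp add: ennreal_numeral[symmetric] del: ennreal_numeral)
  have "1 / r = ennreal (1 / \<rho>)"
    using real \<rho> by (simp add: divide_ennreal[symmetric])
  then have "ennreal (q / 2 + 1 / \<rho>) = 1" using qr q \<rho> by simp
  then have conj: "q / 2 + 1 / \<rho> = 1" by (simp only: ennreal_eq_1)
  have "0 < 1 / \<rho>" using \<rho> by simp
  then have q2: "q < 2" using conj by linarith
  define I where "I = (\<integral>\<^sup>+ \<omega>. ennpowr (D \<omega>) \<rho> \<partial>M)"
  have "I \<noteq> \<infinity>" using fin real \<rho> by (auto simp: Lp_norm_def I_def ennpowr_def)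
  \<comment> \<open>Adding 1 ensures \<open>G \<ge> 1\<close>, which later gives
    \<open>G + A \<le> G * (1 + A)\<close>.\<close>
  define G where "G = enn2real I + 1"
  have G: "I \<le> ennreal G" "1 \<le> G" using \<open>I \<noteq> \<infinity>\<close> by (cases I; simp add: G_def ennreal_leI)+
  have young: "d * ennpowr x q \<le> ennreal (n powr q) * (ennpowr d \<rho> + ennreal (1 / n\<^sup>2) * x\<^sup>2)" if n: "0 < n" for d x n
  proof (cases "d = \<infinity> \<or> x = \<infinity>")
    case True
    then have "ennreal (n powr q) * (ennpowr d \<rho> + ennreal (1 / n\<^sup>2) * x\<^sup>2) = \<infinity>"
      using n by (auto simp: ennpowr_def ennreal_mult_top power_top_ennreal)
    then show ?thesis by simp
  next
    case False
    then obtain a b where ab: "d = ennreal a" "x = ennreal b" "0 \<le> a" "0 \<le> b"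
      by (metis ennreal_cases infinity_ennreal_def)
    \<comment> \<open>Scaling by \<open>n\<close> before applying Young's inequality makes both
      resulting terms bounded independently of \<open>n\<close> after integration; the whole growth
      sits in the factor \<open>n powr q\<close>.\<close>
    define w where "w = b / n"
    have w: "0 \<le> w" "b = n * w" using ab n by (auto simp: w_def)
    have p: "1 < 2 / q" "1 / \<rho> + 1 / (2 / q) = 1" using q q2 conj by auto
    have "a * w powr q \<le> a powr \<rho> / \<rho> + (w powr q) powr (2 / q) / (2 / q)"
      using \<rho> ab p by (intro Youngs_inequality) auto
    also have "\<dots> \<le> a powr \<rho> + w\<^sup>2"
    proof (rule add_mono)
      show "a powr \<rho> / \<rho> \<le> a powr \<rho>" using \<rho> mult_left_mono[of 1 \<rho> "a powr \<rho>"] by (simp add: divide_le_eq)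
      have "(w powr q) powr (2 / q) = w\<^sup>2" using w q by (simp add: powr_powr)
      then show "(w powr q) powr (2 / q) / (2 / q) \<le> w\<^sup>2" using q by (simp add: divide_le_eq mult_left_mono)
    qed
    finally have "n powr q * (a * w powr q) \<le> n powr q * (a powr \<rho> + w\<^sup>2)" by (rule mult_left_mono) simp
    moreover have "n powr q * (a * w powr q) = a * b powr q" using w n by (simp add: powr_mult)
    moreover have "w\<^sup>2 = 1 / n\<^sup>2 * b\<^sup>2" by (simp add: w_def power_divide)
    ultimately have "ennreal (a * b powr q) \<le> ennreal (n powr q * (a powr \<rho> + 1 / n\<^sup>2 * b\<^sup>2))"
      by (intro ennreal_leI) simp
    moreover have "ennreal (1 / n\<^sup>2) * ennreal (b\<^sup>2) = ennreal (b\<^sup>2 / n\<^sup>2)"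
      by (simp add: ennreal_mult'[symmetric])
    ultimately show ?thesis using ab n
      by (simp add: ennpowr_ennreal ennreal_mult' ennreal_power)
  qed
  show ?thesis
  proof (rule that[of G])
    show "0 \<le> G" using G by simp
    fix x :: "'a \<Rightarrow> ennreal" and n A :: real
    assume x[measurable]: "x \<in> borel_measurable M" and n: "0 < n" and A: "0 \<le> A" "(\<integral>\<^sup>+ \<omega>. (x \<omega>)\<^sup>2 \<partial>M) \<le> ennreal (A * n\<^sup>2)"
    have "(\<integral>\<^sup>+ \<omega>. D \<omega> * ennpowr (x \<omega>) q \<partial>M) \<le>
       (\<integral>\<^sup>+ \<omega>. ennreal (n powr q) * (ennpowr (D \<omega>) \<rho> + ennreal (1 / n\<^sup>2) * (x \<omega>)\<^sup>2) \<partial>M)"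
      by (intro nn_integral_mono young n)
    also have "\<dots> = ennreal (n powr q) * (I + ennreal (1 / n\<^sup>2) * (\<integral>\<^sup>+ \<omega>. (x \<omega>)\<^sup>2 \<partial>M))"
      unfolding I_def using measurable_ennpowr[OF D]
      by (simp add: nn_integral_cmult nn_integral_add)
    also have "\<dots> \<le> ennreal (n powr q) * (ennreal G + ennreal (1 / n\<^sup>2) * ennreal (A * n\<^sup>2))"
      using A G by (intro mult_left_mono add_mono) auto
    also have "\<dots> = ennreal (n powr q * (G + A))"
    proof -
      have "ennreal (1 / n\<^sup>2) * ennreal (A * n\<^sup>2) = ennreal A" using n by (simp add: ennreal_mult'[symmetric])
      then show ?thesis using A G by (simp add: ennreal_mult')
    qed
    also have "\<dots> \<le> ennreal (G * (1 + A) * n powr q)"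
    proof (rule ennreal_leI)
      have "G + A \<le> G * (1 + A)" using G A mult_right_mono[of 1 G A] by (simp add: algebra_simps)
      then show "n powr q * (G + A) \<le> G * (1 + A) * n powr q" using mult_left_mono[of "G + A" "G * (1 + A)" "n powr q"] by (simp add: mult.commute)
    qed
    finally show "(\<integral>\<^sup>+ \<omega>. D \<omega> * ennpowr (x \<omega>) q \<partial>M) \<le> ennreal (G * (1 + A) * n powr q)" .
  qed
qed

section \<open>Knot counts of combined nets\<close>

lemma T_det_props:
  assumes "\<tau> \<in> T_det T" "0 < T"
  shows "0 \<in> set \<tau>" "T \<in> set \<tau>" "set \<tau> \<subseteq> {0..T}" "card (set \<tau>) = length \<tau>"
proof -
  have ne: "\<tau> \<noteq> []" and s: "sorted_wrt (<) \<tau>" and hl: "hd \<tau> = 0" "last \<tau> = T"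
    using assms by (auto simp: T_det_def)
  show "0 \<in> set \<tau>" "T \<in> set \<tau>" using hd_in_set[OF ne] last_in_set[OF ne] hl by auto
  have sd: "sorted \<tau>" "distinct \<tau>" using s by (auto simp: strict_sorted_iff)
  then show "card (set \<tau>) = length \<tau>" by (simp add: distinct_card)
  show "set \<tau> \<subseteq> {0..T}"
  proof
    fix x assume "x \<in> set \<tau>"
    then obtain i where i: "i < length \<tau>" "x = \<tau> ! i" by (auto simp: in_set_conv_nth)
    have "\<tau> ! 0 \<le> \<tau> ! i" "\<tau> ! i \<le> \<tau> ! (length \<tau> - 1)"
      using sd i by (auto intro: sorted_nth_mono)
    then show "x \<in> {0..T}" using i hl ne by (simp add: hd_conv_nth last_conv_nth)
  qed
qed

context price_process
begin

lemma jump_S_eq: "AE \<omega> in M. \<forall>t\<in>{0<..T}. jump S t \<omega> = \<sigma> (left_limit S t \<omega>) * jump Z t \<omega>"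
proof -
  obtain I where I: "stochastic_integral M F T (\<lambda>t \<omega>. \<sigma> (left_limit S t \<omega>)) Z I"
    "AE \<omega> in M. \<forall>t\<in>{0..T}. S t \<omega> = s0 + I t \<omega>"
    using S_solution by blast
  have CL: "I \<in> CL M F T" using I(1) by (simp add: stochastic_integral_def)
  from stochastic_integral_jump[OF I(1)] I(2) AE_space show ?thesis
  proof eventually_elim
    case (elim \<omega>)
    show ?case
    proof
      fix t assume t: "t \<in> {0<..T}"
      have "((\<lambda>s. I s \<omega>) \<longlongrightarrow> left_limit I t \<omega>) (at_left t)"
        using cadlag_path_left_limit[of T "\<lambda>s. I s \<omega>", OF _ t] CL elim(3) t by (auto simp: CL_def left_limit_def)
      then have "((\<lambda>s. s0 + I s \<omega>) \<longlongrightarrow> s0 + left_limit I t \<omega>) (at_left t)" by (intro tendsto_intros)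
      moreover have "\<forall>\<^sub>F s in at_left t. s0 + I s \<omega> = S s \<omega>"
        using eventually_at_left_real[of 0 t] t elim(2) by (auto elim!: eventually_mono)
      ultimately have "((\<lambda>s. S s \<omega>) \<longlongrightarrow> s0 + left_limit I t \<omega>) (at_left t)"
        by (rule Lim_transform_eventually)
      then have "left_limit S t \<omega> = s0 + left_limit I t \<omega>" using t by (simp add: left_limit_def tendsto_Lim)
      then have "jump S t \<omega> = jump I t \<omega>" using elim(2) t by (simp add: jump_def)
      then show "jump S t \<omega> = \<sigma> (left_limit S t \<omega>) * jump Z t \<omega>" using elim(1) t by simp
    qed
  qed
qed

text \<open>Positivity of \<sigma> cancels it from the threshold for the jumps of \<open>S\<close>,
  leaving the one for \<open>Z\<close>. Finiteness lets \<open>range_rho\<close> apply, and the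
  extra points 0 and \<open>T\<close> found there are knots of every deterministic net.\<close>

lemma num_knots_eq:
  assumes \<tau>: "\<tau> \<in> T_det T"
    and fin: "AE \<omega> in M. finite (jump_times T Z (\<lambda>t. \<epsilon> * npow (T - t) \<kappa>) \<omega>)"
  shows "AE \<omega> in M. num_knots (combined_net T \<sigma> S \<tau> \<epsilon> \<kappa> \<omega>) =
    emeasure (count_space UNIV) (set \<tau> \<union> jump_times T Z (\<lambda>t. \<epsilon> * npow (T - t) \<kappa>) \<omega>)"
  using fin jump_S_eq AE_space
proof eventually_elim
  case (elim \<omega>)
  have eq: "{t \<in> {0<..T}. \<bar>jump S t \<omega>\<bar> > \<sigma> (left_limit S t \<omega>) * \<epsilon> * npow (T - t) \<kappa>} =
     jump_times T Z (\<lambda>t. \<epsilon> * npow (T - t) \<kappa>) \<omega>" (is "?J = _")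
    unfolding jump_times_def
  proof (intro Collect_cong conj_cong refl)
    fix t assume t: "t \<in> {0<..T}"
    then have "0 < \<sigma> (left_limit S t \<omega>)" using S_mem[OF elim(3), of t] \<sigma>_pos by auto
    then show "\<sigma> (left_limit S t \<omega>) * \<epsilon> * npow (T - t) \<kappa> < \<bar>jump S t \<omega>\<bar> \<longleftrightarrow> \<epsilon> * npow (T - t) \<kappa> < \<bar>jump Z t \<omega>\<bar>"
      using elim(2) t by (simp add: abs_mult mult.assoc)
  qed
  have "range (\<lambda>i. rho T \<sigma> S \<epsilon> \<kappa> i \<omega>) = {0} \<union> ?J \<union> {T}"
    using elim(1) T_pos by (intro range_rho) (simp_all only: eq)
  then have "combined_net T \<sigma> S \<tau> \<epsilon> \<kappa> \<omega> = set \<tau> \<union> jump_times T Z (\<lambda>t. \<epsilon> * npow (T - t) \<kappa>) \<omega>"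
    using T_det_props(1,2)[OF \<tau> T_pos] unfolding combined_net_def eq by auto
  then show ?case by (simp add: num_knots_def)
qed

lemma num_knots_second_moment:
  assumes \<tau>: "\<tau> \<in> T_det T" "length \<tau> = n + 1" and \<epsilon>: "0 < \<epsilon>" and \<kappa>: "0 \<le> \<kappa>" and L: "0 \<le> L"
    and bound: "AE \<omega> in M. emeasure (\<pi>Z \<omega>) (big_marks (\<lambda>t. \<epsilon> * npow (T - t) \<kappa>)) \<le> ennreal L"
  defines "N \<equiv> \<lambda>\<omega>. num_knots (combined_net T \<sigma> S \<tau> \<epsilon> \<kappa> \<omega>)"
  shows "N \<in> borel_measurable M"
    "(\<integral>\<^sup>+ \<omega>. (N \<omega>)\<^sup>2 \<partial>M) \<le> ennreal (2 * ((real n + 1)\<^sup>2 + (2 * L + 1) * L))"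
proof -
  define g where "g t = \<epsilon> * npow (T - t) \<kappa>" for t
  have g: "continuous_on {0..T} g" unfolding g_def by (rule continuous_on_npow[OF \<kappa>])
  have g0: "0 \<le> g t" if "t \<in> {0..T}" for t using \<epsilon> by (simp add: g_def npow_def)
  have Z: "Z \<in> CL M F T" using Z_semimartingale by (simp add: semimartingale_def)
  define NJ where "NJ \<omega> = emeasure (count_space UNIV) (jump_times T Z g \<omega>)" for \<omega>
  note mom = jump_count_moments[OF Z \<pi>Z_compensator g g0 bound[folded g_def], folded NJ_def]
  have NJ[measurable]: "NJ \<in> borel_measurable M" by (rule mom(1))
  have "AE \<omega> in M. NJ \<omega> \<noteq> \<infinity>" using mom(2) by (intro nn_integral_PInf_AE NJ) (auto simp: top_unique)
  then have fin: "AE \<omega> in M. finite (jump_times T Z g \<omega>)"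
    by eventually_elim (auto simp: NJ_def emeasure_count_space split: if_splits)
  define K where "K \<omega> = emeasure (count_space UNIV) (set \<tau> \<union> jump_times T Z g \<omega>)" for \<omega>
  have NK: "AE \<omega> in M. N \<omega> = K \<omega>"
    unfolding N_def K_def g_def by (rule num_knots_eq[OF \<tau>(1) fin[unfolded g_def]])
  note props = T_det_props[OF \<tau>(1) T_pos]
  have K: "K \<in> borel_measurable M"
  proof -
    \<comment> \<open>The knot 0 is split off as a constant summand, since the partition argument
      behind the measurability works on (0, T].\<close>
    have "K = (\<lambda>\<omega>. emeasure (count_space UNIV) {0::real} + emeasure (count_space UNIV) ((set \<tau> - {0}) \<union> (jump_times T Z g \<omega> \<inter> {..T})))"
      unfolding K_def using props(1)
      by (intro ext, subst plus_emeasure) (auto simp: jump_times_def intro!: arg_cong[where f="emeasure _"])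
    moreover have "(\<lambda>\<omega>. emeasure (count_space UNIV) ((set \<tau> - {0}) \<union> (jump_times T Z g \<omega> \<inter> {..T}))) \<in> borel_measurable M"
      using props(3) T_pos by (intro measurable_F_M[OF measurable_count_jump_times[OF Z g g0]]) auto
    ultimately show ?thesis by simp
  qed
  \<comment> \<open>\<open>K\<close> is the count expressed through \<open>Z\<close>; measurability
    passes to \<open>N\<close> by completeness.\<close>
  show "N \<in> borel_measurable M"
    by (rule measurable_AE_eq[OF K]) (use NK in \<open>auto elim: eventually_mono\<close>)
  have K_le: "K \<omega> \<le> ennreal (real n + 1) + NJ \<omega>" for \<omega>
  proof -
    have "K \<omega> \<le> emeasure (count_space UNIV) (set \<tau>) + NJ \<omega>"
      unfolding K_def NJ_def by (intro emeasure_subadditive) auto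
    also have "emeasure (count_space UNIV) (set \<tau>) = ennreal (real n + 1)"
      using props(4) \<tau>(2) by (simp add: emeasure_count_space_finite ennreal_of_nat_eq_real_of_nat add.commute)
    finally show ?thesis .
  qed
  have "(\<integral>\<^sup>+ \<omega>. (N \<omega>)\<^sup>2 \<partial>M) = (\<integral>\<^sup>+ \<omega>. (K \<omega>)\<^sup>2 \<partial>M)"
    using NK by (intro nn_integral_cong_AE) (auto elim: eventually_mono)
  also have "\<dots> \<le> (\<integral>\<^sup>+ \<omega>. 2 * ((ennreal (real n + 1))\<^sup>2 + (NJ \<omega>)\<^sup>2) \<partial>M)"
    by (intro nn_integral_mono order_trans[OF power_mono[OF K_le] square_add_le_ennreal]) auto
  also have "\<dots> = 2 * ((ennreal (real n + 1))\<^sup>2 + (\<integral>\<^sup>+ \<omega>. (NJ \<omega>)\<^sup>2 \<partial>M))"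
    by (simp add: nn_integral_cmult nn_integral_add emeasure_space_1)
  also have "\<dots> \<le> 2 * ((ennreal (real n + 1))\<^sup>2 + (2 * ennreal L + 1) * ennreal L)"
    using mom(3) by (intro mult_left_mono add_left_mono) auto
  also have "\<dots> = ennreal (2 * ((real n + 1)\<^sup>2 + (2 * L + 1) * L))"
  proof -
    have "(ennreal (real n + 1))\<^sup>2 = ennreal ((real n + 1)\<^sup>2)" by (intro ennreal_power) simp
    moreover have "(2 * ennreal L + 1) * ennreal L = ennreal ((2 * L + 1) * L)"
      using L by (simp add: ennreal_mult')
    moreover have "2 * (ennreal a + ennreal b) = ennreal (2 * (a + b))" if "0 \<le> a" "0 \<le> b" for a b
      using that by (subst ennreal_mult') simp_all
    ultimately show ?thesis using L by simp
  qed
  finally show "(\<integral>\<^sup>+ \<omega>. (N \<omega>)\<^sup>2 \<partial>M) \<le> ennreal (2 * ((real n + 1)\<^sup>2 + (2 * L + 1) * L))" .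
qed

end

text \<open>If \<open>X\<close> is not measurable its norm is \<infinity> by convention and the
  bound is immediate; otherwise it is monotonicity of the integral on a space of mass one.\<close>

lemma Lp_norm_lower:
  assumes "prob_space Q" "1 \<le> q" "0 \<le> c" "\<And>\<omega>. ennreal c \<le> X \<omega>"
  shows "ennreal c \<le> Lp_norm Q (ennreal q) X"
proof -
  interpret prob_space Q by fact
  have "ennreal (c powr q) = (\<integral>\<^sup>+ \<omega>. ennpowr (ennreal c) q \<partial>Q)"
    using assms by (simp add: ennpowr_ennreal emeasure_space_1)
  also have "\<dots> \<le> (\<integral>\<^sup>+ \<omega>. ennpowr (X \<omega>) q \<partial>Q)"
    using assms by (intro nn_integral_mono ennpowr_mono) auto
  finally have "ennpowr (ennreal (c powr q)) (1 / q) \<le> ennpowr (\<integral>\<^sup>+ \<omega>. ennpowr (X \<omega>) q \<partial>Q) (1 / q)"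
    using assms by (intro ennpowr_mono) auto
  moreover have "ennpowr (ennreal (c powr q)) (1 / q) = ennreal c"
    using assms by (simp add: ennpowr_ennreal powr_powr)
  ultimately show ?thesis using assms by (simp add: Lp_norm_def)
qed

lemma Lp_norm_upper:
  assumes X: "X \<in> borel_measurable Q" and q: "1 \<le> q" and c: "0 \<le> c"
    and int: "(\<integral>\<^sup>+ \<omega>. ennpowr (X \<omega>) q \<partial>Q) \<le> ennreal c"
  shows "Lp_norm Q (ennreal q) X \<le> ennreal (c powr (1 / q))"
  using ennpowr_mono[OF int, of "1 / q"] X q c by (simp add: Lp_norm_def ennpowr_ennreal)

theorem proposition3p16:
  fixes M Q :: "'a measure" and F :: "real \<Rightarrow> 'a measure" and T z0 s0 :: real
    and Z Zc aZ bZ S :: "'a process"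
    and \<pi>Z :: "'a \<Rightarrow> (real \<times> real) measure" and \<nu> :: "real \<Rightarrow> 'a \<Rightarrow> real measure"
    and R\<^sub>S :: "real set" and \<sigma> :: "real \<Rightarrow> real"
    and q \<alpha> :: real and r :: ennreal
  assumes setting: "price_process M F T Z z0 Zc \<pi>Z \<nu> aZ bZ S s0 R\<^sub>S \<sigma>"
    and q: "1 \<le> q" "q \<le> 2" and r: "2 \<le> r" and qr: "ennreal (q / 2) + 1 / r = 1"
    and Q: "prob_space Q" "sets Q = sets M" "absolutely_continuous M Q"
    and density: "Lp_norm M r (RN_deriv M Q) < \<infinity>"
    and \<alpha>: "0 < \<alpha>" "\<alpha> \<le> 2"
    and small_jumps:
      "(SUP r'\<in>{0<..<1}. Lp_norm (M \<Otimes>\<^sub>M time_space T) \<infinity>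
          (\<lambda>(\<omega>, t). ennreal (r' powr \<alpha>) * emeasure (\<nu> t \<omega>) {z. r' < \<bar>z\<bar> \<and> \<bar>z\<bar> \<le> 1})) < \<infinity>"
  shows "\<forall>\<theta>\<in>{0<..1}. \<forall>\<epsilon> :: nat \<Rightarrow> real.
           (\<forall>n\<ge>1. 0 < \<epsilon> n) \<and> 0 < (INF n\<in>{1..}. real n powr (1 / \<alpha>) * \<epsilon> n) \<longrightarrow>
           (\<exists>c :: real. 1 \<le> c \<and>
              (\<forall>n\<ge>1. \<forall>\<tau>\<in>T_det T. length \<tau> = n + 1 \<longrightarrow>
                 ennreal (real n / c)
                   \<le> Lp_norm Q (ennreal q) (\<lambda>\<omega>. num_knots (combined_net T \<sigma> S \<tau> (\<epsilon> n) ((1 - \<theta>) / 2) \<omega>)) \<and>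
                 Lp_norm Q (ennreal q) (\<lambda>\<omega>. num_knots (combined_net T \<sigma> S \<tau> (\<epsilon> n) ((1 - \<theta>) / 2) \<omega>))
                   \<le> ennreal (c * real n)))"
proof (intro ballI allI impI)
  fix \<theta> :: real and \<epsilon> :: "nat \<Rightarrow> real"
  assume \<theta>: "\<theta> \<in> {0<..1}"
    and \<epsilon>_asm: "(\<forall>n\<ge>1. 0 < \<epsilon> n) \<and> 0 < (INF n\<in>{1..}. real n powr (1 / \<alpha>) * \<epsilon> n)"
  interpret price_process M F T Z z0 Zc \<pi>Z \<nu> aZ bZ S s0 R\<^sub>S \<sigma> by (rule setting)
  define \<kappa> where "\<kappa> = (1 - \<theta>) / 2"
  \<comment> \<open>With \<alpha> \<le> 2 this gives \<kappa>\<alpha> \<le> 1 - \<theta>, and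
    \<theta> > 0 makes it strictly less than 1.\<close>
  have "\<kappa> * \<alpha> \<le> \<kappa> * 2" using \<theta> \<alpha> by (intro mult_left_mono) (auto simp: \<kappa>_def)
  then have \<kappa>: "0 \<le> \<kappa>" "\<kappa> * \<alpha> < 1" using \<theta> by (auto simp: \<kappa>_def)
  define c0 where "c0 = (INF n\<in>{1..}. real n powr (1 / \<alpha>) * \<epsilon> n)"
  have \<epsilon>: "0 < \<epsilon> n" if "1 \<le> n" for n using \<epsilon>_asm that by blast
  have c0: "0 < c0" using \<epsilon>_asm by (simp add: c0_def)
  have c0_le: "c0 \<le> real n powr (1 / \<alpha>) * \<epsilon> n" if "1 \<le> n" for n
    unfolding c0_def using that \<epsilon> by (intro cINF_lower bdd_belowI2[of _ 0]) (auto simp: less_imp_le)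
  \<comment> \<open>The power -\<alpha> reverses the inequality against the infimum
    \<open>c0\<close> and turns the factor \<open>real n powr (1 / \<alpha>)\<close> into
    1/n.\<close>
  have \<epsilon>_powr: "\<epsilon> n powr (-\<alpha>) \<le> c0 powr (-\<alpha>) * n" if n: "1 \<le> n" for n
  proof -
    have "(real n powr (1 / \<alpha>) * \<epsilon> n) powr (-\<alpha>) \<le> c0 powr (-\<alpha>)"
      using c0 c0_le[OF n] \<alpha> by (intro powr_mono2') auto
    moreover have "(real n powr (1 / \<alpha>) * \<epsilon> n) powr (-\<alpha>) = \<epsilon> n powr (-\<alpha>) / n"
      using \<alpha> \<epsilon>[OF n] n by (simp add: powr_mult powr_powr powr_minus_divide)
    ultimately show ?thesis using n by (simp add: divide_le_eq)
  qed
  obtain K0 where K0: "0 \<le> K0" "\<And>\<epsilon>. 0 < \<epsilon> \<Longrightarrow> AE \<omega> in M. emeasure (\<pi>Z \<omega>) (big_marks (\<lambda>t. \<epsilon> * npow (T - t) \<kappa>)) \<le> ennreal (K0 * (\<epsilon> powr (-\<alpha>) + 1))"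
    using compensator_big_marks_bound[OF \<alpha>(1) \<kappa> small_jumps] by blast
  define L where "L = K0 * (c0 powr (-\<alpha>) + 1)"
  have L: "0 \<le> L" using K0(1) by (simp add: L_def)
  have bound: "AE \<omega> in M. emeasure (\<pi>Z \<omega>) (big_marks (\<lambda>t. \<epsilon> n * npow (T - t) \<kappa>)) \<le> ennreal (L * n)" if n: "1 \<le> n" for n
  proof -
    have "\<epsilon> n powr (-\<alpha>) + 1 \<le> (c0 powr (-\<alpha>) + 1) * n"
      using \<epsilon>_powr[OF n] n by (simp add: algebra_simps)
    then have "K0 * (\<epsilon> n powr (-\<alpha>) + 1) \<le> L * n"
      using K0(1) by (simp add: L_def mult.assoc mult_left_mono)
    then show ?thesis using K0(2)[OF \<epsilon>[OF n]] by (auto elim!: eventually_mono intro: order_trans ennreal_leI)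
  qed
  \<comment> \<open>For n \<ge> 1 one has (n+1)^2 \<le> 4 n^2 and L n \<le> L n^2, so the second
    moment bound with \<open>L * n\<close> in place of \<open>L\<close> is at most
    \<open>A * (real n)\<^sup>2\<close>.\<close>
  define A where "A = 2 * (4 + (2 * L + 1) * L)"
  have A: "0 \<le> A" using L by (simp add: A_def)
  have D[measurable]: "RN_deriv M Q \<in> borel_measurable M" by simp
  \<comment> \<open>\<open>G\<close> is chosen before \<open>n\<close> and the net, so the final
    constant is uniform in both.\<close>
  obtain G where G: "0 \<le> G"
    "\<And>x n A. \<lbrakk>x \<in> borel_measurable M; 0 < n; 0 \<le> A; (\<integral>\<^sup>+ \<omega>. (x \<omega>)\<^sup>2 \<partial>M) \<le> ennreal (A * n\<^sup>2)\<rbrakk> \<Longrightarrow>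
       (\<integral>\<^sup>+ \<omega>. RN_deriv M Q \<omega> * ennpowr (x \<omega>) q \<partial>M) \<le> ennreal (G * (1 + A) * n powr q)"
    using density_moment_bound[OF D density q r qr] by blast
  \<comment> \<open>The q-th root of the moment constant serves the upper bound; the maximum with 1
    makes \<open>real n / c\<close> at most \<open>n\<close> for the lower one.\<close>
  define c where "c = max 1 ((G * (1 + A)) powr (1 / q))"
  show "\<exists>c :: real. 1 \<le> c \<and>
              (\<forall>n\<ge>1. \<forall>\<tau>\<in>T_det T. length \<tau> = n + 1 \<longrightarrow>
                 ennreal (real n / c)
                   \<le> Lp_norm Q (ennreal q) (\<lambda>\<omega>. num_knots (combined_net T \<sigma> S \<tau> (\<epsilon> n) ((1 - \<theta>) / 2) \<omega>)) \<and>
                 Lp_norm Q (ennreal q) (\<lambda>\<omega>. num_knots (combined_net T \<sigma> S \<tau> (\<epsilon> n) ((1 - \<theta>) / 2) \<omega>))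
                   \<le> ennreal (c * real n))"
    unfolding \<kappa>_def[symmetric]
  proof (intro exI[of _ c] conjI allI impI ballI)
    show c1: "1 \<le> c" by (simp add: c_def)
    fix n :: nat and \<tau> assume n: "1 \<le> n" and \<tau>: "\<tau> \<in> T_det T" "length \<tau> = n + 1"
    define N where "N \<omega> = num_knots (combined_net T \<sigma> S \<tau> (\<epsilon> n) \<kappa> \<omega>)" for \<omega>
    \<comment> \<open>This holds for every \<omega>, because the knots of \<tau> are always
      present.\<close>
    have "ennreal n \<le> N \<omega>" for \<omega>
    proof -
      have "ennreal n \<le> emeasure (count_space UNIV) (set \<tau>)"
        using T_det_props(4)[OF \<tau>(1) T_pos] \<tau>(2)
        by (simp add: emeasure_count_space_finite ennreal_of_nat_eq_real_of_nat[symmetric])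
      also have "\<dots> \<le> N \<omega>" unfolding N_def num_knots_def by (intro emeasure_mono) (auto simp: combined_net_def)
      finally show ?thesis .
    qed
    then have "ennreal n \<le> Lp_norm Q (ennreal q) N" using Q q by (intro Lp_norm_lower) auto
    moreover have "real n / c \<le> n" using c1 n by (simp add: divide_le_eq)
    ultimately show "ennreal (real n / c) \<le> Lp_norm Q (ennreal q) (\<lambda>\<omega>. num_knots (combined_net T \<sigma> S \<tau> (\<epsilon> n) \<kappa> \<omega>))"
      unfolding N_def by (meson ennreal_leI order_trans)
    have Ln: "0 \<le> L * n" using L by simp
    note mom = num_knots_second_moment[OF \<tau> \<epsilon>[OF n] \<kappa>(1) Ln bound[OF n], folded N_def]
    have N: "N \<in> borel_measurable M" using mom(1) unfolding N_def .
    have "2 * ((real n + 1)\<^sup>2 + (2 * (L * n) + 1) * (L * n)) \<le> A * (real n)\<^sup>2"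
    proof -
      have "(real n + 1)\<^sup>2 \<le> (2 * real n)\<^sup>2" using n by (intro power_mono) auto
      moreover have "L * real n \<le> L * (real n * real n)" using L n by (intro mult_left_mono) (simp_all add: mult_le_cancel_left1)
      ultimately show ?thesis by (simp add: A_def power2_eq_square algebra_simps)
    qed
    then have "(\<integral>\<^sup>+ \<omega>. (N \<omega>)\<^sup>2 \<partial>M) \<le> ennreal (A * (real n)\<^sup>2)"
      using mom(2) by (meson ennreal_leI order_trans)
    then have "(\<integral>\<^sup>+ \<omega>. RN_deriv M Q \<omega> * ennpowr (N \<omega>) q \<partial>M) \<le> ennreal (G * (1 + A) * real n powr q)"
      using n A by (intro G(2) N) auto
    moreover have "(\<integral>\<^sup>+ \<omega>. ennpowr (N \<omega>) q \<partial>Q) = (\<integral>\<^sup>+ \<omega>. RN_deriv M Q \<omega> * ennpowr (N \<omega>) q \<partial>M)"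
      using Q N by (intro RN_deriv_nn_integral measurable_ennpowr) auto
    moreover have "N \<in> borel_measurable Q" using N measurable_cong_sets[OF Q(2) refl] by blast
    moreover have "0 \<le> G * (1 + A) * real n powr q" using G(1) A by simp
    ultimately have "Lp_norm Q (ennreal q) N \<le> ennreal ((G * (1 + A) * real n powr q) powr (1 / q))"
      using q(1) by (intro Lp_norm_upper) simp_all
    also have "(G * (1 + A) * real n powr q) powr (1 / q) = (G * (1 + A)) powr (1 / q) * n"
      using G(1) A q by (simp add: powr_mult powr_powr)
    also have "ennreal \<dots> \<le> ennreal (c * n)" by (intro ennreal_leI mult_right_mono) (auto simp: c_def)
    finally show "Lp_norm Q (ennreal q) (\<lambda>\<omega>. num_knots (combined_net T \<sigma> S \<tau> (\<epsilon> n) \<kappa> \<omega>)) \<le> ennreal (c * n)"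
      unfolding N_def .
  qed
qed

end
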